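(* Let $\theta>0$ and let $\mathbf P$ be a GEM$(\theta)$ sequence. Let $\mathbf T=\{T_j\}_{j\ge1}$ be a homogeneous Markov chain on a discrete space $\mathcal X$, independent of $\mathbf P$, with transition kernel $Q$ and initial distribution $\mu$. Let $\mathbf V$ be the switch times of $\mathbf T$, $\mathbf P^{\mathbf V}$ the corresponding clumped measure, and $\mathbf Y=\{T_{V_j}\}_{j\ge1}$. Then $\mathbf Y$ is a homogeneous Markov chain with kernel $K_{\theta(Q-I)}$, and for every possible sequence $\mathbf y$ of $\mathbf Y$, $\mathbf P^{\mathbf V}\mid\mathbf Y=\mathbf y$ is a disordered GEM with parameters $\{\theta(1-Q_{y_j,y_j})\}_{j\ge1}$. That is, $(\mathbf P^{\mathbf V},\mathbf Y)$ has the MCcGEM$(\theta(Q-I))$ distribution with respect to $\mu$.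
   Context: Conventions: empty sums $0$, empty products $1$, $1/0=\infty$, $0/0=0$, $0^0=1$; a Beta$(1,0)$ variable equals $1$ a.s. RAM constructed from independent $[0,1]$-valued fractions $\{X_j\}$: $P_j=X_j\prod_{i<j}(1-X_i)$, required to sum to $1$ a.s. GEM$(\theta)$: the RAM with i.i.d. Beta$(1,\theta)$ fractions. Disordered GEM with parameters $\{\theta_j\}_{j\ge1}$ ($\theta_j\ge0$): the RAM with independent fractions $X_j\sim$ Beta$(1,\theta_j)$. Switch times: $V_1=1$, $V_{j+1}=\inf\{v>V_j:T_v\ne T_{v-1}\}$ ($\inf\emptyset=\infty$); $Y_j=T_{V_j}$ if $V_j<\infty$ and $Y_j$ equals the absorbing state reached otherwise. Clumped measure $\mathbf P^{\mathbf V}$: $P^V_j=\sum_{i=V_j}^{V_{j+1}-1}P_i$ if $V_j<\infty$, else $0$. A generator kernel on $\mathcal X$ is a matrix $G$ with $G_{i,j}\ge0$ for $i\ne j$, $G_{i,i}=-\sum_{j\ne i}G_{i,j}$, and $\sup_i|G_{i,i}|<\infty$. For a generator $G$, $K_G(w,z)=G_{w,z}/(-G_{w,w})$ if $w\ne z$ and $G_{w,w}\ne0$; $K_G(w,z)=1$ if $w=z$ and $G_{w,w}=0$; $K_G(w,z)=0$ otherwise. MCcGEM$(G)$ distribution with respect to $\mu$: the law of a pair $(\mathbf P,\mathbf Y)$ where $\mathbf Y$ is a homogeneous Markov chain with initial law $\mu$ and kernel $K_G$, and conditionally on $\mathbf Y=\mathbf y$ the variables $X_j$ are independent with $X_j\sim$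 Beta$(1,-G_{y_j,y_j})$, and $P_j=X_j\prod_{i<j}(1-X_i)$. A possible sequence $\mathbf y$ of $\mathbf Y$: $\mathbb P(Y_i=y_i,1\le i\le n)>0$ for all $n$. *)

theory Defs
  imports "HOL-Probability.Probability"
begin

definition beta1 :: "real \<Rightarrow> real measure" where
  "beta1 th = (if th = 0 then return borel 1
     else density lborel (\<lambda>x. ennreal (indicator {0<..<1} x * th * (1 - x) powr (th - 1))))"

definition RAM :: "(nat \<Rightarrow> real) \<Rightarrow> nat \<Rightarrow> real" where
  "RAM X j = X j * (\<Prod>i<j. 1 - X i)"

definition markov_fd :: "'x pmf \<Rightarrow> ('x \<Rightarrow> 'x \<Rightarrow> real) \<Rightarrow> nat \<Rightarrow> (nat \<Rightarrow> 'x) \<Rightarrow> real" where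
  "markov_fd mu K n y = (if n = 0 then 1
     else pmf mu (y 0) * (\<Prod>i\<in>{1..<n}. K (y (i - 1)) (y i)))"

definition KG :: "('x \<Rightarrow> 'x \<Rightarrow> real) \<Rightarrow> 'x \<Rightarrow> 'x \<Rightarrow> real" where
  "KG G w z = (if w \<noteq> z \<and> G w w \<noteq> 0 then G w z / (- G w w)
     else if w = z \<and> G w w = 0 then 1 else 0)"

fun switch :: "(nat \<Rightarrow> 'x) \<Rightarrow> nat \<Rightarrow> enat" where
  "switch T 0 = 0"
| "switch T (Suc j) = (if switch T j = \<infinity> then \<infinity>
     else if (\<exists>v. enat v > switch T j \<and> T v \<noteq> T (v - 1))
       then enat (LEAST v. enat v > switch T j \<and> T v \<noteq> T (v - 1)) else \<infinity>)"

(* Y_j = T_{V_j} if V_j finite, otherwise the absorbing state reached *)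
fun switchY :: "(nat \<Rightarrow> 'x) \<Rightarrow> nat \<Rightarrow> 'x" where
  "switchY T 0 = T 0"
| "switchY T (Suc j) = (case switch T (Suc j) of enat v \<Rightarrow> T v | \<infinity> \<Rightarrow> switchY T j)"

definition clumped :: "(nat \<Rightarrow> enat) \<Rightarrow> (nat \<Rightarrow> real) \<Rightarrow> nat \<Rightarrow> real" where
  "clumped V P j = (if V j = \<infinity> then 0
     else (\<Sum>i. if V j \<le> enat i \<and> enat i < V (Suc j) then P i else 0))"

abbreviation seqR :: "(nat \<Rightarrow> real) measure" where
  "seqR \<equiv> PiM UNIV (\<lambda>_. borel)"

abbreviation seqX :: "(nat \<Rightarrow> 'x) measure" where
  "seqX \<equiv> PiM UNIV (\<lambda>_. count_space UNIV)"

(* N is the MCcGEM(G) distribution w.r.t. mu: N is the law of (P, Y), where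
   (X, Y) has a joint law L such that Y is a Markov chain with initial law mu and
   kernel K_G, and conditionally on Y = y the X_j are independent Beta(1, -G y_j y_j)
   (expressed through finite-dimensional distributions), and P = RAM X. *)
definition is_MCcGEM :: "'x pmf \<Rightarrow> ('x \<Rightarrow> 'x \<Rightarrow> real) \<Rightarrow> ((nat \<Rightarrow> real) \<times> (nat \<Rightarrow> 'x)) measure \<Rightarrow> bool" where
  "is_MCcGEM mu G N \<longleftrightarrow> (\<exists>L. prob_space L \<and> sets L = sets (seqR \<Otimes>\<^sub>M seqX) \<and>
     (\<forall>n y B. (\<forall>i<n. B i \<in> sets borel) \<longrightarrow>
        measure L {xy \<in> space L. \<forall>i<n. snd xy i = y i \<and> fst xy i \<in> B i}
          = markov_fd mu (KG G) n y * (\<Prod>i<n. measure (beta1 (- G (y i) (y i))) (B i))) \<and>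
     N = distr L (seqR \<Otimes>\<^sub>M seqX) (\<lambda>xy. (RAM (fst xy), snd xy)))"

end

(* Give each visited state the time the chain holds there (0 if it stays forever). The pairs
   (state, holding time) are a K_G-chain with independent geometric holding times. Since T is
   independent of X, the fraction removed by a clump of k sticks is 1 - (1 - X_1)...(1 - X_k),
   and -ln of the product is a sum of k exponential variables, hence Erlang(k). A geometric
   mixture of Erlang laws with success probability 1 - q is exponential with rate
   theta (1 - q), so given Y = y the clump fractions are independent Beta(1, theta (1 - q)),
   where q = Q(y_j, y_j). *)
theory Submission
  imports Defs
begin

section \<open>Beta fractions and geometric mixtures of blocks\<close>

text \<open>Conditioning on \<open>Y\<close> alone shows no product structure, because the stick
  indices that make up a clump are random. Once the whole vector of holding times is fixed as well,
  the clumps are deterministic disjoint index intervals, and independence of the sticks applies to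
  them. The holding times are then summed out: a sum over vectors of products factors into one
  geometric mixture per clump. Absorption is the obstacle that shapes the rest.
  \<open>switchY\<close> repeats the absorbing state forever, so each further pair must be matched
  with jump weight \<open>1\<close>, hold \<open>0\<close> and fraction \<open>1\<close>; a hold
  \<open>0\<close> shifts no start index and uses no stick. The match is only almost sure, since
  exceptional paths may leave an absorbing state or stay forever in another one. Likewise an
  infinite clump carries all the remaining mass only if the sticks exhaust the unit mass.\<close>

lemma sets_beta1 [simp, measurable_cong]: "sets (beta1 th) = sets borel"
  by (simp add: beta1_def)

lemma space_beta1 [simp]: "space (beta1 th) = UNIV"
  by (simp add: beta1_def)

text \<open>For \<open>th < 1\<close> the density is unbounded at \<open>1\<close>, and
  \<open>u = 1\<close> is allowed. The fundamental theorem is therefore used in its improper form,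
  with an antiderivative on the open interval and its one-sided limits at the ends.\<close>

lemma emeasure_beta1_atMost:
  assumes "th > 0" "0 < u" "u \<le> 1"
  shows "emeasure (beta1 th) {..u} = ennreal (1 - (1 - u) powr th)"
proof -
  let ?F = "\<lambda>x::real. - ((1 - x) powr th)"
  let ?f = "\<lambda>x::real. th * (1 - x) powr (th - 1)"
  have cont: "(?F \<longlongrightarrow> ?F c) (at c within S)" if "S \<subseteq> {..1}" for c S
    using assms that
    by (intro tendsto_minus tendsto_powr' tendsto_diff tendsto_const tendsto_ident_at)
       (auto simp: eventually_at_filter intro!: always_eventually)
  have lim: "((?F \<circ> real_of_ereal) \<longlongrightarrow> ?F 0) (at_right (ereal 0))"
            "((?F \<circ> real_of_ereal) \<longlongrightarrow> ?F u) (at_left (ereal u))"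
    unfolding ereal_tendsto_simps
  proof -
    have "(?F \<longlongrightarrow> ?F 0) (at_right 0)"
      using assms by (auto intro!: tendsto_eq_intros)
    then show "(?F \<longlongrightarrow> ?F 0) (at_right 0)" .
    show "(?F \<longlongrightarrow> ?F u) (at_left u)"
      using assms by (intro cont) auto
  qed
  have ftc: "set_integrable lborel (einterval (ereal 0) (ereal u)) ?f"
     "(LBINT x=ereal 0..ereal u. ?f x) = ?F u - ?F 0"
    by (rule interval_integral_FTC_nonneg[where F = ?F, OF _ _ _ _ lim];
        use assms in \<open>auto intro!: derivative_eq_intros continuous_intros simp: powr_diff\<close>)+
  have "emeasure (beta1 th) {..u} =
      (\<integral>\<^sup>+x. ennreal (indicator {0<..<1} x * th * (1 - x) powr (th - 1)) * indicator {..u} x \<partial>lborel)"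
    using assms by (simp add: beta1_def emeasure_density)
  also have "\<dots> = (\<integral>\<^sup>+x. ennreal (indicator {0<..<u} x * ?f x) \<partial>lborel)"
    using AE_lborel_singleton[of u]
    by (intro nn_integral_cong_AE, eventually_elim) (use assms in \<open>auto split: split_indicator\<close>)
  also have "\<dots> = ennreal (LBINT x. indicator {0<..<u} x * ?f x)"
    using ftc(1) assms
    by (intro nn_integral_eq_integral) (auto simp: set_integrable_def split: split_indicator)
  also have "(LBINT x. indicator {0<..<u} x * ?f x) = (LBINT x=ereal 0..ereal u. ?f x)"
    using assms by (simp only: interval_lebesgue_integral_def set_lebesgue_integral_def) simp
  finally show ?thesis
    by (simp only: ftc(2)) simp
qed

lemma AE_beta1:
  assumes "th > 0"
  shows "AE x in beta1 th. 0 < x \<and> x < 1"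
proof -
  have "AE x in lborel. 0 < ennreal (indicator {0<..<1} x * th * (1 - x) powr (th - 1)) \<longrightarrow> 0 < x \<and> x < (1::real)"
    by (rule AE_I2) (auto split: split_indicator_asm)
  with assms show ?thesis
    by (simp only: beta1_def) (simp add: AE_density del: AE_conj_iff)
qed

lemma prob_space_beta1:
  assumes "th \<ge> 0"
  shows "prob_space (beta1 th)"
proof (cases "th = 0")
  case True
  then show ?thesis by (simp add: beta1_def prob_space_return)
next
  case False
  with assms have th: "th > 0" by simp
  have "AE x in beta1 th. x \<in> {..1}"
    using AE_beta1[OF th] by eventually_elim simp
  then have "emeasure (beta1 th) (space (beta1 th)) = emeasure (beta1 th) {..1}"
    by (intro emeasure_eq_AE) auto
  also have "\<dots> = 1"
    using th emeasure_beta1_atMost[of th 1] by simp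
  finally show ?thesis
    by (rule prob_spaceI)
qed

lemma distributed_neg_ln_beta1:
  assumes "th > 0"
  shows "distributed (beta1 th) lborel (\<lambda>x. - ln (1 - x)) (exponential_density th)"
proof (rule exponential_distributedI)
  fix a :: real assume a: "0 \<le> a"
  have "emeasure (beta1 th) {x \<in> space (beta1 th). - ln (1 - x) \<le> a} = emeasure (beta1 th) {..1 - exp (- a)}"
  proof (rule emeasure_eq_AE)
    show "AE x in beta1 th. (x \<in> {x \<in> space (beta1 th). - ln (1 - x) \<le> a}) = (x \<in> {..1 - exp (- a)})"
      using AE_beta1[OF assms]
    proof eventually_elim
      case (elim x)
      have "- ln (1 - x) \<le> a \<longleftrightarrow> exp (- a) \<le> 1 - x"
        using elim ln_ge_iff[of "1 - x" "- a"] by linarith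
      then show ?case by auto
    qed
  qed auto
  also have "\<dots> = ennreal (1 - exp (- a * th))"
  \<comment> \<open>The distribution function is available for \<open>u > 0\<close> only, so
    \<open>a = 0\<close>, which corresponds to \<open>u = 0\<close>, is treated apart.\<close>
  proof (cases "a = 0")
    case True
    have "AE x in beta1 th. x \<notin> {..0}" using AE_beta1[OF assms] by eventually_elim auto
    then have "emeasure (beta1 th) {..0} = 0" by (subst (asm) AE_iff_measurable[where N="{..0}"]) auto
    with True show ?thesis by simp
  next
    case False
    with a assms show ?thesis by (subst emeasure_beta1_atMost) (auto simp: powr_def)
  qed
  finally show "emeasure (beta1 th) {x \<in> space (beta1 th). - ln (1 - x) \<le> a} = 1 - ennreal (exp (- a * th))"
    by (simp add: ennreal_minus ennreal_1[symmetric] del: ennreal_1)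
qed (use assms in auto)

text \<open>The way back from the logarithmic scale: mixtures are computed on densities of
  \<open>- ln (1 - x)\<close> and then returned to fractions. The two maps are inverse to each other
  on \<open>0 < x < 1\<close>, hence almost surely.\<close>

lemma beta1_eq_distr_exponential:
  assumes "th > 0"
  shows "beta1 th = distr (density lborel (exponential_density th)) borel (\<lambda>s. 1 - exp (- s))"
proof -
  have "distr (beta1 th) lborel (\<lambda>x. - ln (1 - x)) = density lborel (exponential_density th)"
    using distributed_neg_ln_beta1[OF assms] by (simp add: distributed_def)
  then have "distr (density lborel (exponential_density th)) borel (\<lambda>s. 1 - exp (- s))
      = distr (distr (beta1 th) lborel (\<lambda>x. - ln (1 - x))) borel (\<lambda>s. 1 - exp (- s))"
    by simp
  also have "\<dots> = distr (beta1 th) borel (\<lambda>x. 1 - exp (ln (1 - x)))"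
    by (subst distr_distr) (auto simp: comp_def)
  also have "\<dots> = distr (beta1 th) (beta1 th) (\<lambda>x. x)"
    by (rule distr_cong_AE) (use AE_beta1[OF assms] in \<open>simp_all, eventually_elim, simp\<close>)
  finally show ?thesis by simp
qed

text \<open>The hold time \<open>0\<close> stands for an infinite hold, which the chain has exactly in its
  absorbing states.\<close>

definition hold_pmf :: "real \<Rightarrow> nat pmf" where
  "hold_pmf q = (if q = 1 then return_pmf 0 else map_pmf Suc (geometric_pmf (1 - q)))"

text \<open>The law of the fraction removed by \<open>k\<close> consecutive sticks. The index
  \<open>k - 1\<close> is due to \<open>erlang_density\<close>, which counts from \<open>0\<close>:
  index \<open>0\<close> is a single exponential variable. An infinite clump takes all that remains,
  hence the point mass at \<open>1\<close>.\<close>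

definition block_law :: "real \<Rightarrow> nat \<Rightarrow> real measure" where
  "block_law th k = (if k = 0 then return borel 1
     else distr (density lborel (erlang_density (k - 1) th)) borel (\<lambda>s. 1 - exp (- s)))"

lemma sets_block_law [simp, measurable_cong]: "sets (block_law th k) = sets borel"
  by (simp add: block_law_def)

lemma space_block_law [simp]: "space (block_law th k) = UNIV"
  by (simp add: block_law_def)

text \<open>The powers \<open>q ^ k\<close> combine with the terms
  \<open>(th * x) ^ k / fact k\<close> of the Erlang densities into the series of
  \<open>exp (q * th * x)\<close>, which lowers the rate from \<open>th\<close> to
  \<open>th * (1 - q)\<close>.\<close>

lemma erlang_geometric_sums:
  assumes "0 \<le> q" "q < 1" "0 < th"
  shows "(\<lambda>k. q ^ k * (1 - q) * erlang_density k th x) sums exponential_density (th * (1 - q)) x"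
proof (cases "x < 0")
  case True
  then show ?thesis by (simp add: erlang_density_def)
next
  case False
  have "(\<lambda>k. th * (1 - q) * exp (- th * x) * ((q * th * x) ^ k /\<^sub>R fact k))
     sums (th * (1 - q) * exp (- th * x) * exp (q * th * x))"
    by (intro sums_mult exp_converges)
  also have "th * (1 - q) * exp (- th * x) * exp (q * th * x) = exponential_density (th * (1 - q)) x"
    using False by (simp add: exponential_density_def algebra_simps flip: exp_add)
  also have "(\<lambda>k. th * (1 - q) * exp (- th * x) * ((q * th * x) ^ k /\<^sub>R fact k))
     = (\<lambda>k. q ^ k * (1 - q) * erlang_density k th x)"
    using False by (auto simp: erlang_density_def field_simps power_mult_distrib fun_eq_iff)
  finally show ?thesis .
qed

text \<open>One clump with its hold summed out. At \<open>q = 1\<close> the hold is infinite and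
  both sides are the point mass at \<open>1\<close>, in agreement with the convention for
  Beta(1,0).\<close>

lemma nn_integral_block_law:
  assumes "0 \<le> q" "q \<le> 1" "0 < th" and [measurable]: "B \<in> sets borel"
  shows "(\<integral>\<^sup>+k. emeasure (block_law th k) B \<partial>hold_pmf q) = emeasure (beta1 (th * (1 - q))) B"
proof (cases "q = 1")
  case True
  then show ?thesis
    by (simp add: hold_pmf_def block_law_def beta1_def nn_integral_return)
next
  case False
  with assms have q: "q < 1" by simp
  let ?g = "\<lambda>s::real. 1 - exp (- s)"
  have em: "emeasure (distr (density lborel (erlang_density k l)) borel ?g) B =
      (\<integral>\<^sup>+s. ennreal (erlang_density k l s) * indicator (?g -` B) s \<partial>lborel)" for k l
    using measurable_sets[of ?g borel borel B] by (simp add: emeasure_distr emeasure_density)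
  \<comment> \<open>The summation index is now the hold minus one, so the geometric weight and the
    Erlang index run together.\<close>
  have "(\<integral>\<^sup>+k. emeasure (block_law th k) B \<partial>hold_pmf q) =
     (\<integral>\<^sup>+k. ennreal (q ^ k * (1 - q)) * (\<integral>\<^sup>+s. ennreal (erlang_density k th s) * indicator (?g -` B) s \<partial>lborel) \<partial>count_space UNIV)"
    using False q assms(1) by (simp add: hold_pmf_def block_law_def em) (simp add: nn_integral_measure_pmf)
  also have "\<dots> = (\<Sum>k. \<integral>\<^sup>+s. ennreal (q ^ k * (1 - q)) * (ennreal (erlang_density k th s) * indicator (?g -` B) s) \<partial>lborel)"
    by (simp add: nn_integral_count_space_nat nn_integral_cmult)
  also have "\<dots> = (\<integral>\<^sup>+s. (\<Sum>k. ennreal (q ^ k * (1 - q)) * (ennreal (erlang_density k th s) * indicator (?g -` B) s)) \<partial>lborel)"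
    by (rule nn_integral_suminf[symmetric]) auto
  also have "\<dots> = (\<integral>\<^sup>+s. ennreal (exponential_density (th * (1 - q)) s) * indicator (?g -` B) s \<partial>lborel)"
  proof (rule nn_integral_cong)
    fix s
    have "(\<Sum>k. ennreal (q ^ k * (1 - q)) * (ennreal (erlang_density k th s) * indicator (?g -` B) s))
       = (\<Sum>k. ennreal (q ^ k * (1 - q) * erlang_density k th s)) * indicator (?g -` B) s"
      using assms q by (simp add: ennreal_mult mult.assoc flip: ennreal_suminf_multc)
    also have "(\<Sum>k. ennreal (q ^ k * (1 - q) * erlang_density k th s)) = ennreal (exponential_density (th * (1 - q)) s)"
      using assms q by (intro suminf_ennreal_eq erlang_geometric_sums) auto
    finally show "(\<Sum>k. ennreal (q ^ k * (1 - q)) * (ennreal (erlang_density k th s) * indicator (?g -` B) s))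
       = ennreal (exponential_density (th * (1 - q)) s) * indicator (?g -` B) s" .
  qed
  also have "\<dots> = emeasure (beta1 (th * (1 - q))) B"
    using assms q by (subst beta1_eq_distr_exponential) (simp_all add: em)
  finally show ?thesis .
qed

lemma (in prob_space) distr_block_law:
  fixes X :: "'i \<Rightarrow> 'a \<Rightarrow> real"
  assumes K: "finite K" "K \<noteq> {}" and th: "0 < th"
    and indep: "indep_vars (\<lambda>_. borel) X K"
    and X: "\<And>j. j \<in> K \<Longrightarrow> distr M borel (X j) = beta1 th"
  shows "distr M borel (\<lambda>\<omega>. 1 - (\<Prod>j\<in>K. 1 - X j \<omega>)) = block_law th (card K)"
proof -
  have [measurable]: "X j \<in> borel_measurable M" if "j \<in> K" for j
    using indep that by (auto simp: indep_vars_def)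
  define S where "S = (\<lambda>\<omega>. \<Sum>j\<in>K. - ln (1 - X j \<omega>))"
  have lt: "AE \<omega> in M. X j \<omega> < 1" if "j \<in> K" for j
    using AE_beta1[OF th] unfolding X[OF that, symmetric]
    by (subst (asm) AE_distr_iff) (use that in auto)
  have "distributed M lborel (\<lambda>\<omega>. - ln (1 - X j \<omega>)) (exponential_density th)" if "j \<in> K" for j
  proof -
    have "distr M lborel (\<lambda>\<omega>. - ln (1 - X j \<omega>)) = distr (distr M borel (X j)) lborel (\<lambda>x. - ln (1 - x))"
      using that by (subst distr_distr) (auto simp: comp_def)
    also have "\<dots> = density lborel (exponential_density th)"
      using distributed_neg_ln_beta1[OF th] X[OF that] by (simp add: distributed_def)
    finally show ?thesis
      using that th by (auto simp: distributed_def)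
  qed
  moreover have "indep_vars (\<lambda>_. borel) (\<lambda>j \<omega>. - ln (1 - X j \<omega>)) K"
    by (rule indep_vars_compose2[OF indep]) auto
  ultimately have "distributed M lborel S (erlang_density (card K - 1) th)"
    unfolding S_def using K th by (intro exponential_distributed_sum) auto
  then have S: "distr M lborel S = density lborel (erlang_density (card K - 1) th)"
    and [measurable]: "S \<in> borel_measurable M"
    by (auto simp: distributed_def)
  \<comment> \<open>\<open>exp\<close> undoes \<open>ln\<close> only where \<open>1 - X j\<close> is
    positive, so the product equals \<open>exp (- S)\<close> almost surely.\<close>
  have "AE \<omega> in M. \<forall>j\<in>K. X j \<omega> < 1"
    using K lt by (simp add: AE_finite_all)
  then have "AE \<omega> in M. 1 - (\<Prod>j\<in>K. 1 - X j \<omega>) = 1 - exp (- S \<omega>)"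
    by eventually_elim (use K in \<open>auto simp: S_def exp_sum sum_negf intro!: prod.cong\<close>)
  then have "distr M borel (\<lambda>\<omega>. 1 - (\<Prod>j\<in>K. 1 - X j \<omega>)) = distr M borel (\<lambda>\<omega>. 1 - exp (- S \<omega>))"
    by (intro distr_cong_AE) auto
  also have "\<dots> = distr (distr M lborel S) borel (\<lambda>s. 1 - exp (- s))"
    by (subst distr_distr) (auto simp: comp_def)
  finally show ?thesis
    using K by (simp add: S block_law_def)
qed

text \<open>The factor \<open>1 - x\<close> raises the exponent of the density by one and turns it
  into \<open>th / (th + 1)\<close> times the density of Beta(1, th + 1), whose total mass is
  \<open>1\<close>.\<close>

lemma nn_integral_beta1_diff:
  assumes "th > 0"
  shows "(\<integral>\<^sup>+x. ennreal (1 - x) \<partial>beta1 th) = ennreal (th / (th + 1))"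
proof -
  have "(\<integral>\<^sup>+x. ennreal (1 - x) \<partial>beta1 th) =
     (\<integral>\<^sup>+x. ennreal (indicator {0<..<1} x * th * (1 - x) powr (th - 1)) * ennreal (1 - x) \<partial>lborel)"
    using assms by (simp add: beta1_def nn_integral_density)
  also have "\<dots> = (\<integral>\<^sup>+x. ennreal (th / (th + 1)) *
      ennreal (indicator {0<..<1} x * (th + 1) * (1 - x) powr (th + 1 - 1)) \<partial>lborel)"
  proof (rule nn_integral_cong)
    fix x :: real
    have "indicator {0<..<1} x * th * (1 - x) powr (th - 1) * (1 - x)
        = th / (th + 1) * (indicator {0<..<1} x * (th + 1) * (1 - x) powr (th + 1 - 1))"
      using assms by (auto simp: powr_diff split: split_indicator)
    then show "ennreal (indicator {0<..<1} x * th * (1 - x) powr (th - 1)) * ennreal (1 - x)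
      = ennreal (th / (th + 1)) * ennreal (indicator {0<..<1} x * (th + 1) * (1 - x) powr (th + 1 - 1))"
      using assms by (cases "x \<in> {0<..<1}") (simp_all flip: ennreal_mult)
  qed
  also have "\<dots> = ennreal (th / (th + 1)) * emeasure (beta1 (th + 1)) (space (beta1 (th + 1)))"
    using assms by (simp add: nn_integral_cmult beta1_def emeasure_density)
  also have "emeasure (beta1 (th + 1)) (space (beta1 (th + 1))) = 1"
    using assms by (intro prob_space.emeasure_space_1 prob_space_beta1) simp
  finally show ?thesis by simp
qed

section \<open>Switch times and holding times of a path\<close>

text \<open>Replaces the \<open>LEAST\<close> of the recursion by a description through constant
  runs, the form in which a path can be compared with prescribed states and run lengths.\<close>

lemma switch_Suc_eq_enat_iff:
  "switch t (Suc j) = enat v \<longleftrightarrow>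
    (\<exists>u<v. switch t j = enat u \<and> (\<forall>i\<in>{u..<v}. t i = t u) \<and> t v \<noteq> t u)"
proof (cases "switch t j")
  case (enat u)
  define P where "P = (\<lambda>v. u < v \<and> t v \<noteq> t (v - 1))"
  \<comment> \<open>The definition compares neighbouring times, whereas a run is compared with its
    first state; up to the first change the two agree, by induction along the run.\<close>
  have const: "(\<forall>i<v. \<not> P i) \<longleftrightarrow> (\<forall>i\<in>{u..<v}. t i = t u)" for v
  proof
    assume *: "\<forall>i<v. \<not> P i"
    have "t (u + m) = t u" if "u + m < v" for m
      using that
    proof (induction m)
      case (Suc m)
      then show ?case using *[rule_format, of "u + Suc m"] by (auto simp: P_def)
    qed simp
    then show "\<forall>i\<in>{u..<v}. t i = t u"
      by (metis atLeastLessThan_iff le_Suc_ex)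
  next
    assume *: "\<forall>i\<in>{u..<v}. t i = t u"
    show "\<forall>i<v. \<not> P i"
    proof (intro allI impI notI)
      fix i assume "i < v" "P i"
      then have "i \<in> {u..<v}" "i - 1 \<in> {u..<v}" "t i \<noteq> t (i - 1)"
        by (auto simp: P_def)
      then show False
        using * by metis
    qed
  qed
  have "switch t (Suc j) = enat v \<longleftrightarrow> (\<exists>v. P v) \<and> (LEAST v. P v) = v"
    using enat by (auto simp: P_def)
  also have "\<dots> \<longleftrightarrow> P v \<and> (\<forall>i<v. \<not> P i)"
  proof safe
    show "P (LEAST v. P v)" if "P w" for w
      using that by (rule LeastI)
    show False if "P i" "i < (LEAST v. P v)" for i
      using that not_less_Least by blast
  next
    assume "P v" "\<forall>i<v. \<not> P i"
    then show "(LEAST v. P v) = v"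
      by (intro Least_equality) (meson linorder_not_less)+
  qed auto
  also have "\<dots> \<longleftrightarrow> u < v \<and> (\<forall>i<v. \<not> P i) \<and> t v \<noteq> t u"
  proof -
    have "t (v - 1) = t u" if "u < v" "\<forall>i<v. \<not> P i"
      using that(1) by (intro that(2)[unfolded const, rule_format]) auto
    moreover have "P v \<longleftrightarrow> u < v \<and> t v \<noteq> t (v - 1)"
      by (simp add: P_def)
    ultimately show ?thesis
      by metis
  qed
  also note const
  finally show ?thesis
    using enat by simp
qed simp

lemma switch_Suc_eq_infinity_iff:
  assumes "switch t j = enat u"
  shows "switch t (Suc j) = \<infinity> \<longleftrightarrow> (\<forall>v\<ge>u. t v = t u)"
proof -
  have "switch t (Suc j) \<noteq> \<infinity> \<longleftrightarrow> (\<exists>v. switch t (Suc j) = enat v)"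
    by auto
  also have "\<dots> \<longleftrightarrow> (\<exists>v>u. (\<forall>i\<in>{u..<v}. t i = t u) \<and> t v \<noteq> t u)"
    unfolding switch_Suc_eq_enat_iff using assms by auto
  also have "\<dots> \<longleftrightarrow> (\<exists>v\<ge>u. t v \<noteq> t u)"
  proof
    assume "\<exists>v\<ge>u. t v \<noteq> t u"
    then obtain v where "u \<le> v \<and> t v \<noteq> t u" "\<And>i. i < v \<Longrightarrow> \<not> (u \<le> i \<and> t i \<noteq> t u)"
      using exists_least_iff[of "\<lambda>v. u \<le> v \<and> t v \<noteq> t u"] by blast
    then have "u < v" "\<forall>i\<in>{u..<v}. t i = t u" "t v \<noteq> t u"
      by (metis le_neq_implies_less, metis atLeastLessThan_iff, blast)
    then show "\<exists>v>u. (\<forall>i\<in>{u..<v}. t i = t u) \<and> t v \<noteq> t u"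
      by blast
  qed (meson less_imp_le)
  finally show ?thesis by blast
qed

lemma switch_Suc_from_iff:
  assumes "switch t j = enat u" "t u = w"
  shows "switch t (Suc j) = enat v \<longleftrightarrow> u < v \<and> (\<forall>i\<in>{u..<v}. t i = w) \<and> t v \<noteq> w"
    and "switch t (Suc j) = \<infinity> \<longleftrightarrow> (\<forall>v\<ge>u. t v = w)"
  unfolding assms(2)[symmetric] switch_Suc_eq_infinity_iff[OF assms(1)] switch_Suc_eq_enat_iff assms(1)
  by blast+

lemma switchY_eq: "switch t j = enat u \<Longrightarrow> switchY t j = t u"
  by (cases j) (simp_all add: enat_0_iff del: switch.simps(2))

lemma switchY_Suc_infinity: "switch t (Suc j) = \<infinity> \<Longrightarrow> switchY t (Suc j) = switchY t j"
  by (simp del: switch.simps(2))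

section \<open>Holding times and paths with prescribed runs\<close>

declare switch.simps(2) [simp del] switchY.simps(2) [simp del]

text \<open>A finite hold is positive because switch times increase strictly, so \<open>0\<close> is
  free to encode an infinite one. Every index after absorption gets \<open>0\<close> as well, hence
  looks like one more infinite hold.\<close>

definition hold :: "(nat \<Rightarrow> 'x) \<Rightarrow> nat \<Rightarrow> nat" where
  "hold t j = (case switch t (Suc j) of enat v \<Rightarrow> v - the_enat (switch t j) | \<infinity> \<Rightarrow> 0)"

lemma hold_eq_0_iff: "hold t j = 0 \<longleftrightarrow> switch t (Suc j) = \<infinity>"
proof (cases "switch t (Suc j)")
  case (enat v)
  then obtain u where "u < v" "switch t j = enat u"
    unfolding switch_Suc_eq_enat_iff by auto
  with enat show ?thesis by (simp add: hold_def)
qed (simp add: hold_def)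

lemma hold_eq_iff:
  assumes "0 < k"
  shows "hold t j = k \<longleftrightarrow> (\<exists>u. switch t j = enat u \<and> switch t (Suc j) = enat (u + k))"
proof (cases "switch t (Suc j)")
  case (enat v)
  then obtain u where "u < v" "switch t j = enat u"
    unfolding switch_Suc_eq_enat_iff by auto
  with enat show ?thesis by (auto simp: hold_def)
qed (use assms in \<open>simp add: hold_def\<close>)

text \<open>The last state \<open>y n\<close> is kept forever, so that the length of the last hold
  can be imposed as a separate condition, finite or infinite.\<close>

fun run_path :: "(nat \<Rightarrow> nat) \<Rightarrow> (nat \<Rightarrow> 'x) \<Rightarrow> nat \<Rightarrow> nat \<Rightarrow> 'x" where
  "run_path k y 0 = (\<lambda>_. y 0)"
| "run_path k y (Suc n) = (\<lambda>j. if j < sum k {..<Suc n} then run_path k y n j else y (Suc n))"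

lemma run_path_eq: "sum k {..<n} \<le> j \<Longrightarrow> run_path k y n j = y n"
  by (cases n) auto

lemma run_path_agree_iff:
  assumes "sum k {..<n} < m"
  shows "(\<forall>j<m. t j = run_path k y n j) \<longleftrightarrow>
    (\<forall>j\<le>sum k {..<n}. t j = run_path k y n j) \<and> (\<forall>j\<in>{sum k {..<n}..<m}. t j = y n)"
    (is "?A \<longleftrightarrow> ?B \<and> ?C")
proof (intro iffI conjI)
  assume ?A
  then show ?B using assms by (meson le_less_trans)
  show ?C
  proof
    fix j assume "j \<in> {sum k {..<n}..<m}"
    then show "t j = y n" using \<open>?A\<close> run_path_eq[of k n j y] by simp
  qed
next
  assume BC: "?B \<and> ?C"
  show ?A
  proof (intro allI impI)
    fix j assume "j < m"
    then show "t j = run_path k y n j"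
      using BC run_path_eq[of k n j y] by (cases "j \<le> sum k {..<n}") simp_all
  qed
qed

text \<open>Positive holds and distinct neighbours make the runs of the path its clumps. The bound
  includes the time \<open>sum k {..<n}\<close>, at which clump \<open>n\<close> begins: the new
  state seen there is what ends the hold before it.\<close>

lemma run_path_iff:
  assumes "\<forall>i<n. 0 < k i" "\<forall>i<n. y i \<noteq> y (Suc i)"
  shows "(\<forall>j\<le>sum k {..<n}. t j = run_path k y n j) \<longleftrightarrow>
    (\<forall>i\<le>n. switch t i = enat (sum k {..<i}) \<and> switchY t i = y i)"
  using assms
proof (induction n)
  case 0
  then show ?case by (simp add: enat_0_iff)
next
  case (Suc n)
  let ?s = "sum k {..<n}"
  have k: "0 < k n" and neq: "y n \<noteq> y (Suc n)"
    using Suc.prems by auto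
  have "(\<forall>j\<le>sum k {..<Suc n}. t j = run_path k y (Suc n) j) \<longleftrightarrow>
    (\<forall>j<?s + k n. t j = run_path k y n j) \<and> t (?s + k n) = y (Suc n)"
    by (auto simp: le_less)
  also have "(\<forall>j<?s + k n. t j = run_path k y n j) \<longleftrightarrow>
      (\<forall>j\<le>?s. t j = run_path k y n j) \<and> (\<forall>j\<in>{?s..<?s + k n}. t j = y n)"
    using k by (intro run_path_agree_iff) simp
  also have "(\<forall>j\<le>?s. t j = run_path k y n j) \<longleftrightarrow>
      (\<forall>i\<le>n. switch t i = enat (sum k {..<i}) \<and> switchY t i = y i)"
    using Suc by auto
  also have "(\<dots> \<and> (\<forall>j\<in>{?s..<?s + k n}. t j = y n)) \<and> t (?s + k n) = y (Suc n) \<longleftrightarrow>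
     (\<forall>i\<le>Suc n. switch t i = enat (sum k {..<i}) \<and> switchY t i = y i)"
    (is "(?A \<and> ?C) \<and> ?D \<longleftrightarrow> _")
  proof -
    have "?C \<and> ?D \<longleftrightarrow> switch t (Suc n) = enat (?s + k n) \<and> switchY t (Suc n) = y (Suc n)" if ?A
    proof -
      have s: "switch t n = enat ?s" and y: "switchY t n = y n"
        using that by auto
      then have "t ?s = y n"
        using switchY_eq[OF s] by simp
      then show ?thesis
        using s k neq switchY_eq[of t "Suc n" "?s + k n"]
        by (auto simp: switch_Suc_from_iff)
    qed
    moreover have all_Suc: "(\<forall>i\<le>Suc n. R i) \<longleftrightarrow> (\<forall>i\<le>n. R i) \<and> R (Suc n)" for R
      by (auto simp: le_Suc_eq)
    ultimately show ?thesis
      unfolding all_Suc sum.lessThan_Suc by blast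
  qed
  finally show ?case .
qed

text \<open>Finite holds and switch times determine each other through partial sums. The hold of
  clump \<open>n\<close> stays a separate condition because it may be infinite.\<close>

lemma switchY_hold_iff:
  assumes "\<forall>i<n. 0 < k i" "\<forall>i<n. y i \<noteq> y (Suc i)"
  shows "(\<forall>i<Suc n. switchY t i = y i \<and> hold t i = k i) \<longleftrightarrow>
    (\<forall>j\<le>sum k {..<n}. t j = run_path k y n j) \<and> hold t n = k n"
proof -
  have 1: "switch t i = enat (sum k {..<i})" if "\<forall>i<n. hold t i = k i" "i \<le> n" for i
    using that(2)
  proof (induction i)
    case (Suc i)
    then show ?case using that(1) hold_eq_iff[of "k i" t i] assms(1) by auto
  qed (simp add: enat_0_iff)
  have 2: "hold t i = k i" if "\<forall>i\<le>n. switch t i = enat (sum k {..<i})" "i < n" for i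
    using that assms(1) by (subst hold_eq_iff) (auto simp: Suc_leI)
  show ?thesis (is "?L \<longleftrightarrow> _")
    unfolding run_path_iff[OF assms]
  proof (intro iffI conjI)
    assume L: ?L
    then show "\<forall>i\<le>n. switch t i = enat (sum k {..<i}) \<and> switchY t i = y i"
      using 1 by simp
    show "hold t n = k n"
      using L by simp
  next
    assume R: "(\<forall>i\<le>n. switch t i = enat (sum k {..<i}) \<and> switchY t i = y i) \<and> hold t n = k n"
    show ?L
    proof (intro allI impI conjI)
      fix i assume "i < Suc n"
      then show "switchY t i = y i" "hold t i = k i"
        using R 2[of i] by (simp, cases "i = n") simp_all
    qed
  qed
qed

text \<open>A finite last hold is a difference of two nested cylinder events: follow the path up to
  a time, but not one step longer. Its probability thus needs no sum over the state entered
  next.\<close>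

lemma switchY_hold_pos_iff:
  assumes "\<forall>i<n. 0 < k i" "\<forall>i<n. y i \<noteq> y (Suc i)" "0 < k n"
  shows "(\<forall>i<Suc n. switchY t i = y i \<and> hold t i = k i) \<longleftrightarrow>
    (\<forall>j<sum k {..<n} + k n. t j = run_path k y n j) \<and> \<not> (\<forall>j<Suc (sum k {..<n} + k n). t j = run_path k y n j)"
proof -
  let ?s = "sum k {..<n}"
  have "hold t n = k n \<longleftrightarrow> (\<forall>j\<in>{?s..<?s + k n}. t j = y n) \<and> t (?s + k n) \<noteq> y n"
    if "\<forall>j\<le>?s. t j = run_path k y n j"
  proof -
    have "switch t n = enat ?s"
      using run_path_iff[OF assms(1,2)] that by simp
    moreover have "t ?s = y n"
      using that run_path_eq[of k n ?s y] by simp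
    ultimately show ?thesis
      using assms(3) by (simp add: hold_eq_iff switch_Suc_from_iff)
  qed
  moreover have "(\<forall>j<?s + k n. t j = run_path k y n j) \<longleftrightarrow>
      (\<forall>j\<le>?s. t j = run_path k y n j) \<and> (\<forall>j\<in>{?s..<?s + k n}. t j = y n)"
    using assms(3) by (intro run_path_agree_iff) simp
  moreover have "run_path k y n (?s + k n) = y n"
    by (simp add: run_path_eq)
  ultimately show ?thesis
    unfolding switchY_hold_iff[OF assms(1,2)] All_less_Suc by metis
qed

lemma switchY_hold_0_iff:
  assumes "\<forall>i<n. 0 < k i" "\<forall>i<n. y i \<noteq> y (Suc i)" "k n = 0"
  shows "(\<forall>i<Suc n. switchY t i = y i \<and> hold t i = k i) \<longleftrightarrow>
    (\<forall>j\<le>sum k {..<n}. t j = run_path k y n j) \<and> (\<forall>j\<ge>sum k {..<n}. t j = y n)"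
proof -
  let ?s = "sum k {..<n}"
  have "hold t n = k n \<longleftrightarrow> (\<forall>j\<ge>?s. t j = y n)"
    if "\<forall>j\<le>?s. t j = run_path k y n j"
  proof -
    have "switch t n = enat ?s"
      using run_path_iff[OF assms(1,2)] that by simp
    moreover have "t ?s = y n"
      using that run_path_eq[of k n ?s y] by simp
    ultimately show ?thesis
      using assms(3) by (simp add: hold_eq_0_iff switch_Suc_from_iff)
  qed
  then show ?thesis
    unfolding switchY_hold_iff[OF assms(1,2)] by auto
qed

lemma switchY_hold_neq:
  assumes "hold t n \<noteq> 0"
  shows "switchY t (Suc n) \<noteq> switchY t n"
proof -
  obtain u v where uv: "switch t n = enat u" "switch t (Suc n) = enat v"
    using assms hold_eq_iff[of "hold t n" t n] by auto
  then show ?thesis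
    unfolding uv[THEN switchY_eq] using switch_Suc_from_iff(1)[OF uv(1) refl] by blast
qed

section \<open>Measurability of switch times, holds and visited states\<close>

lemma pred_component_eq [measurable]:
  "Measurable.pred (seqX :: (nat \<Rightarrow> 'x::countable) measure) (\<lambda>t. t i = t j)"
proof -
  have "Measurable.pred (seqX :: (nat \<Rightarrow> 'x) measure) (\<lambda>t. \<exists>x. t i = x \<and> t j = x)"
    by (intro pred_intros_countable pred_intros_logic pred_eq_const1[where N = "count_space UNIV"]) simp_all
  then show ?thesis by (simp add: eq_commute)
qed

lemma pred_switch_eq_enat [measurable]:
  "Measurable.pred (seqX :: (nat \<Rightarrow> 'x::countable) measure) (\<lambda>t. switch t j = enat u)"
proof (induction j arbitrary: u)
  case (Suc j)
  show ?case
    unfolding switch_Suc_eq_enat_iff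
    by (intro pred_intros_countable_bounded pred_intros_countable pred_intros_logic Suc
        pred_component_eq) simp_all
qed simp

lemma measurable_switch [measurable]:
  "(\<lambda>t. switch t j) \<in> measurable (seqX :: (nat \<Rightarrow> 'x::countable) measure) (count_space UNIV)"
proof -
  have "{t \<in> space (seqX :: (nat \<Rightarrow> 'x) measure). switch t j = a} \<in> sets seqX" for a
  proof (cases a)
    case (enat u)
    then show ?thesis
      using pred_switch_eq_enat[of j u] by (simp add: pred_def)
  next
    case infinity
    have "{t \<in> space (seqX :: (nat \<Rightarrow> 'x) measure). \<forall>u. switch t j \<noteq> enat u} \<in> sets seqX"
      by measurable
    then show ?thesis
      using infinity by simp
  qed
  then show ?thesis
    by (auto simp: measurable_count_space_eq2_countable vimage_def Int_def conj_commute)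
qed

lemma measurable_hold [measurable]:
  "(\<lambda>t. hold t j) \<in> measurable (seqX :: (nat \<Rightarrow> 'x::countable) measure) (count_space UNIV)"
  unfolding hold_def
proof (rule measurable_compose_countable[OF _ measurable_switch])
  fix i
  show "(\<lambda>t. case i of enat v \<Rightarrow> v - the_enat (switch t j) | \<infinity> \<Rightarrow> 0)
    \<in> measurable (seqX :: (nat \<Rightarrow> 'x) measure) (count_space UNIV)"
    by (cases i) (auto intro: measurable_compose[OF measurable_switch])
qed

lemma measurable_switchY [measurable]:
  "(\<lambda>t. switchY t j) \<in> measurable (seqX :: (nat \<Rightarrow> 'x::countable) measure) (count_space UNIV)"
proof (induction j)
  case (Suc j)
  note [measurable] = this
  show ?case
    unfolding switchY.simps(2)
  proof (rule measurable_compose_countable[OF _ measurable_switch])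
    fix i
    show "(\<lambda>t. case i of enat v \<Rightarrow> t v | \<infinity> \<Rightarrow> switchY t j) \<in> measurable (seqX :: (nat \<Rightarrow> 'x) measure) (count_space UNIV)"
      by (cases i) simp_all
  qed
qed simp

section \<open>Joint law of visited states and holding times\<close>

lemma markov_fd_Suc:
  "0 < n \<Longrightarrow> markov_fd mu K (Suc n) y = markov_fd mu K n y * K (y (n - 1)) (y n)"
  by (cases n) (simp_all add: markov_fd_def atLeastLessThanSuc)

lemma markov_fd_cong:
  assumes "\<And>i. i < n \<Longrightarrow> y i = z i"
  shows "markov_fd mu K n y = markov_fd mu K n z"
proof -
  have "(\<Prod>i\<in>{1..<n}. K (y (i - 1)) (y i)) = (\<Prod>i\<in>{1..<n}. K (z (i - 1)) (z i))"
    using assms by (intro prod.cong refl) auto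
  then show ?thesis
    using assms by (simp add: markov_fd_def)
qed

abbreviation (input) clump_generator :: "real \<Rightarrow> ('x \<Rightarrow> 'x \<Rightarrow> real) \<Rightarrow> 'x \<Rightarrow> 'x \<Rightarrow> real" where
  "clump_generator th Q \<equiv> \<lambda>w z. th * (Q w z - (if w = z then 1 else 0))"

locale chain_on_paths = prob_space M
  for M :: "'a measure" +
  fixes T :: "nat \<Rightarrow> 'a \<Rightarrow> 'x::countable"
    and Q :: "'x \<Rightarrow> 'x \<Rightarrow> real" and mu :: "'x pmf" and th :: real
  assumes th: "0 < th"
    and Q_nonneg: "\<And>w z. Q w z \<ge> 0"
    and Q_sum: "\<And>w. ((\<lambda>z. Q w z) has_sum 1) UNIV"
    and T_measurable [measurable]: "\<And>j. T j \<in> measurable M (count_space UNIV)"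
    and T_fd: "\<And>n y. prob {\<omega> \<in> space M. \<forall>i<n. T i \<omega> = y i} = markov_fd mu Q n y"
begin

lemma Q_pair_le:
  assumes "w \<noteq> z"
  shows "Q w w + Q w z \<le> 1"
proof -
  have "sum (Q w) {w, z} \<le> 1"
    by (rule has_sum_mono_neutral[OF has_sum_finite Q_sum]) (auto simp: Q_nonneg)
  then show ?thesis using assms by simp
qed

lemma Q_le_1: "Q w w \<le> 1"
proof -
  have "sum (Q w) {w} \<le> 1"
    by (rule has_sum_mono_neutral[OF has_sum_finite Q_sum]) (auto simp: Q_nonneg)
  then show ?thesis by simp
qed

lemma Q_absorbing: "Q w w = 1 \<Longrightarrow> w \<noteq> z \<Longrightarrow> Q w z = 0"
  using Q_pair_le[of w z] Q_nonneg[of w z] by simp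

lemma pmf_hold:
  "pmf (hold_pmf (Q w w)) k =
     (if Q w w = 1 then (if k = 0 then 1 else 0)
      else if k = 0 then 0 else Q w w ^ (k - 1) * (1 - Q w w))"
proof (cases "Q w w = 1")
  case False
  then have "0 < 1 - Q w w" "1 - Q w w \<le> 1"
    using Q_le_1[of w] Q_nonneg[of w w] by auto
  then show ?thesis
    using False by (cases k) (auto simp: hold_pmf_def pmf_map_inj' pmf_eq_0_set_pmf)
qed (simp add: hold_pmf_def)

text \<open>The holding factor \<open>1 - Q w w\<close> of the geometric weight cancels the
  denominator of the jump kernel. At an absorbing state both sides vanish: a positive hold has
  weight \<open>0\<close> there, and so has the transition to \<open>z\<close>.\<close>

lemma KG_hold:
  assumes "w \<noteq> z"
  shows "KG (clump_generator th Q) w z * pmf (hold_pmf (Q w w)) (Suc m) = Q w w ^ m * Q w z"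
proof (cases "Q w w = 1")
  case True
  then show ?thesis
    unfolding pmf_hold using Q_absorbing[OF True assms] by simp
next
  case False
  then have "th * (Q w w - 1) \<noteq> 0" "1 - Q w w \<noteq> 0" using th by auto
  then show ?thesis
    using assms False th by (simp add: KG_def pmf_hold field_simps)
qed

lemma markov_fd_run_path:
  "markov_fd mu Q (Suc (sum k {..<n} + m)) (run_path k y n) =
     markov_fd mu Q (Suc (sum k {..<n})) (run_path k y n) * Q (y n) (y n) ^ m"
  by (induction m) (simp_all add: markov_fd_Suc[of "Suc _"] run_path_eq)

text \<open>Each completed hold consists of \<open>k i - 1\<close> stays and one jump, and
  \<open>KG_hold\<close> regroups exactly these factors. The path ends on entering
  \<open>y n\<close>, so the weight of the hold at \<open>y n\<close> is still absent.\<close>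

lemma markov_fd_run_path_eq:
  assumes "\<forall>i<n. 0 < k i" "\<forall>i<n. y i \<noteq> y (Suc i)"
  shows "markov_fd mu Q (Suc (sum k {..<n})) (run_path k y n) =
     markov_fd mu (KG (clump_generator th Q)) (Suc n) y * (\<Prod>i<n. pmf (hold_pmf (Q (y i) (y i))) (k i))"
  using assms
proof (induction n)
  case 0
  then show ?case by (simp add: markov_fd_def)
next
  case (Suc n)
  let ?s = "sum k {..<n}" and ?K = "KG (clump_generator th Q)"
  obtain m where m: "k n = Suc m"
    using Suc.prems by (cases "k n") auto
  have "markov_fd mu Q (Suc (sum k {..<Suc n})) (run_path k y (Suc n))
      = markov_fd mu Q (Suc (?s + m)) (run_path k y (Suc n)) * Q (y n) (y (Suc n))"
    using m by (subst markov_fd_Suc) (simp_all add: run_path_eq)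
  also have "markov_fd mu Q (Suc (?s + m)) (run_path k y (Suc n)) = markov_fd mu Q (Suc (?s + m)) (run_path k y n)"
    using m by (intro markov_fd_cong) simp
  also have "\<dots> = markov_fd mu ?K (Suc n) y * (\<Prod>i<n. pmf (hold_pmf (Q (y i) (y i))) (k i)) * Q (y n) (y n) ^ m"
    using Suc by (subst markov_fd_run_path) simp
  finally have "markov_fd mu Q (Suc (sum k {..<Suc n})) (run_path k y (Suc n))
      = markov_fd mu ?K (Suc n) y * (\<Prod>i<n. pmf (hold_pmf (Q (y i) (y i))) (k i)) *
        (Q (y n) (y n) ^ m * Q (y n) (y (Suc n)))"
    by (simp only: mult.assoc)
  also have "Q (y n) (y n) ^ m * Q (y n) (y (Suc n)) = ?K (y n) (y (Suc n)) * pmf (hold_pmf (Q (y n) (y n))) (k n)"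
    using Suc.prems m by (subst m, subst KG_hold) simp_all
  finally show ?case
    by (simp add: markov_fd_Suc[of "Suc n"] mult_ac)
qed

section \<open>Almost sure behaviour at absorbing states\<close>

lemma AE_markov_fd_neq_0: "AE \<omega> in M. \<forall>n. markov_fd mu Q n (\<lambda>i. T i \<omega>) \<noteq> 0"
proof -
  have "AE \<omega> in M. markov_fd mu Q (length p) (\<lambda>i. p ! i) = 0 \<longrightarrow> \<not> (\<forall>i<length p. T i \<omega> = p ! i)" for p
  proof (cases "markov_fd mu Q (length p) (\<lambda>i. p ! i) = 0")
    case True
    then have "prob {\<omega> \<in> space M. \<forall>i<length p. T i \<omega> = p ! i} = 0"
      by (simp add: T_fd)
    then show ?thesis
      by (subst (asm) prob_eq_0) auto
  qed simp
  \<comment> \<open>Finite words over a countable state space are countable in number, so the null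
    events may be united.\<close>
  then have "AE \<omega> in M. \<forall>p. markov_fd mu Q (length p) (\<lambda>i. p ! i) = 0 \<longrightarrow> \<not> (\<forall>i<length p. T i \<omega> = p ! i)"
    by (simp add: AE_all_countable)
  then show ?thesis
  proof eventually_elim
    case (elim \<omega>)
    show ?case
    proof
      fix n
      have "markov_fd mu Q n (\<lambda>i. map (\<lambda>i. T i \<omega>) [0..<n] ! i) \<noteq> 0"
        using elim[rule_format, of "map (\<lambda>i. T i \<omega>) [0..<n]"] by auto
      then show "markov_fd mu Q n (\<lambda>i. T i \<omega>) \<noteq> 0"
        by (subst (asm) markov_fd_cong[where z = "\<lambda>i. T i \<omega>"]) auto
    qed
  qed
qed

lemma AE_stay: "AE \<omega> in M. \<forall>s. Q (T s \<omega>) (T s \<omega>) = 1 \<longrightarrow> T (Suc s) \<omega> = T s \<omega>"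
  using AE_markov_fd_neq_0
proof eventually_elim
  case (elim \<omega>)
  have "Q (T s \<omega>) (T (Suc s) \<omega>) \<noteq> 0" for s
    using elim[rule_format, of "Suc (Suc s)"] by (simp add: markov_fd_Suc)
  then show ?case
    using Q_absorbing by metis
qed

text \<open>Staying forever after a word \<open>p\<close> has probability at most a constant times
  \<open>q ^ m\<close> for every \<open>m\<close>, with \<open>q < 1\<close>. Indexing by words
  instead of times fixes the state of the stay and keeps the family of null events
  countable.\<close>

lemma AE_leave: "AE \<omega> in M. \<forall>s. Q (T s \<omega>) (T s \<omega>) \<noteq> 1 \<longrightarrow> (\<exists>v\<ge>s. T v \<omega> \<noteq> T s \<omega>)"
proof -
  have "AE \<omega> in M. p \<noteq> [] \<and> Q (last p) (last p) \<noteq> 1 \<longrightarrow>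
      \<not> ((\<forall>i<length p. T i \<omega> = p ! i) \<and> (\<forall>i\<ge>length p. T i \<omega> = last p))" for p
  proof (cases "p \<noteq> [] \<and> Q (last p) (last p) \<noteq> 1")
    case True
    let ?q = "Q (last p) (last p)"
    let ?path = "\<lambda>i. if i < length p then p ! i else last p"
    let ?E = "{\<omega> \<in> space M. (\<forall>i<length p. T i \<omega> = p ! i) \<and> (\<forall>i\<ge>length p. T i \<omega> = last p)}"
    have fd: "markov_fd mu Q (length p + m) ?path = markov_fd mu Q (length p) ?path * ?q ^ m" for m
    proof (induction m)
      case (Suc m)
      have "?path (length p + m - 1) = last p"
        using True by (cases m) (simp_all add: last_conv_nth)
      moreover have "?path (length p + m) = last p"
        by simp
      ultimately show ?case
        using True Suc markov_fd_Suc[of "length p + m" mu Q ?path] by simp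
    qed simp
    have "prob ?E \<le> markov_fd mu Q (length p) ?path * ?q ^ m" for m
    proof -
      have "prob ?E \<le> prob {\<omega> \<in> space M. \<forall>i<length p + m. T i \<omega> = ?path i}"
        by (intro finite_measure_mono) auto
      then show ?thesis
        by (simp only: T_fd fd)
    qed
    moreover have "(\<lambda>m. markov_fd mu Q (length p) ?path * ?q ^ m) \<longlonglongrightarrow> markov_fd mu Q (length p) ?path * 0"
      using True Q_le_1[of "last p"] Q_nonneg[of "last p" "last p"]
      by (intro tendsto_mult tendsto_const LIMSEQ_realpow_zero) simp_all
    ultimately have "prob ?E \<le> 0"
      by (intro LIMSEQ_le_const[where X = "\<lambda>m. markov_fd mu Q (length p) ?path * ?q ^ m"]) simp_all
    then have "prob ?E = 0"
      by (simp add: measure_le_0_iff)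
    then show ?thesis
      by (subst (asm) prob_eq_0) auto
  next
    case False
    then show ?thesis by (intro AE_I2) blast
  qed
  then have "AE \<omega> in M. \<forall>p. p \<noteq> [] \<and> Q (last p) (last p) \<noteq> 1 \<longrightarrow>
      \<not> ((\<forall>i<length p. T i \<omega> = p ! i) \<and> (\<forall>i\<ge>length p. T i \<omega> = last p))"
    by (simp add: AE_all_countable)
  then show ?thesis
  proof eventually_elim
    case (elim \<omega>)
    show ?case
    proof (intro allI impI)
      fix s assume "Q (T s \<omega>) (T s \<omega>) \<noteq> 1"
      moreover define p where "p = map (\<lambda>i. T i \<omega>) [0..<Suc s]"
      then have "length p = Suc s" "last p = T s \<omega>" "p \<noteq> []" "\<forall>i<Suc s. T i \<omega> = p ! i"
        by (simp_all add: last_map nth_map_upt del: upt_Suc)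
      ultimately have "\<not> (\<forall>i\<ge>Suc s. T i \<omega> = T s \<omega>)"
        using elim[rule_format, of p] by metis
      then show "\<exists>v\<ge>s. T v \<omega> \<noteq> T s \<omega>"
        using Suc_leD by blast
    qed
  qed
qed

lemma T_seq_measurable [measurable]: "(\<lambda>\<omega> j. T j \<omega>) \<in> measurable M seqX"
  by (intro measurable_abs_UNIV T_measurable)

lemma sets_switchY_hold [measurable]:
  "{\<omega> \<in> space M. \<forall>i<n. switchY (\<lambda>j. T j \<omega>) i = y i \<and> hold (\<lambda>j. T j \<omega>) i = k i} \<in> sets M"
proof -
  have [measurable]: "(\<lambda>\<omega>. switchY (\<lambda>j. T j \<omega>) i) \<in> measurable M (count_space UNIV)"
     "(\<lambda>\<omega>. hold (\<lambda>j. T j \<omega>) i) \<in> measurable M (count_space UNIV)" for i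
    by (rule measurable_compose[OF T_seq_measurable measurable_switchY],
        rule measurable_compose[OF T_seq_measurable measurable_hold])
  show ?thesis by measurable
qed

text \<open>Absorption as seen by the kernel coincides with absorption as seen by the path. Through
  this property an infinite hold, an event about the whole future, is read off a diagonal entry of
  \<open>Q\<close>.\<close>

definition regular_path :: "(nat \<Rightarrow> 'x) \<Rightarrow> bool" where
  "regular_path t \<longleftrightarrow> (\<forall>s. Q (t s) (t s) = 1 \<longleftrightarrow> (\<forall>v\<ge>s. t v = t s))"

lemma AE_regular_path: "AE \<omega> in M. regular_path (\<lambda>j. T j \<omega>)"
  using AE_stay AE_leave
proof eventually_elim
  case (elim \<omega>)
  have "T (s + m) \<omega> = T s \<omega>" if "Q (T s \<omega>) (T s \<omega>) = 1" for s m
    using that elim(1) by (induction m) auto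
  then have "T v \<omega> = T s \<omega>" if "Q (T s \<omega>) (T s \<omega>) = 1" "s \<le> v" for s v
    using that by (metis le_Suc_ex)
  then show ?case
    unfolding regular_path_def using elim(2) by blast
qed

lemma hold_eq_0_iff_absorbing:
  assumes "regular_path t"
  shows "hold t j = 0 \<longleftrightarrow> Q (switchY t j) (switchY t j) = 1"
proof -
  have fin: "switch t (Suc j) = \<infinity> \<longleftrightarrow> Q (switchY t j) (switchY t j) = 1" if "switch t j = enat u" for j u
    using assms switch_Suc_eq_infinity_iff[OF that] switchY_eq[OF that] by (simp only: regular_path_def)
  \<comment> \<open>After absorption \<open>switchY\<close> only repeats, so the induction goes back
    to the last finite switch time, where \<open>fin\<close> applies.\<close>
  have inf: "switch t j = \<infinity> \<Longrightarrow> Q (switchY t j) (switchY t j) = 1" for j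
  proof (induction j)
    case (Suc j)
    then show ?case
      using fin by (cases "switch t j") (simp_all add: switchY_Suc_infinity)
  qed simp
  show ?thesis
    using inf[of j] fin[of j] by (cases "switch t j") (auto simp: hold_eq_0_iff switch.simps(2))
qed

text \<open>The case of \<open>n\<close> genuine clumps followed by one with hold
  \<open>k n\<close>. A positive \<open>k n\<close> gives a difference of cylinder probabilities;
  \<open>k n = 0\<close> gives, almost surely, either the cylinder itself or the empty event,
  depending on whether \<open>y n\<close> is absorbing.\<close>

lemma prob_hold_aux:
  assumes "\<forall>i<n. 0 < k i" "\<forall>i<n. y i \<noteq> y (Suc i)"
  shows "prob {\<omega> \<in> space M. \<forall>i<Suc n. switchY (\<lambda>j. T j \<omega>) i = y i \<and> hold (\<lambda>j. T j \<omega>) i = k i} =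
     markov_fd mu Q (Suc (sum k {..<n})) (run_path k y n) * pmf (hold_pmf (Q (y n) (y n))) (k n)"
    (is "prob ?E = _")
proof (cases "k n")
  case (Suc m)
  let ?s = "sum k {..<n}"
  let ?A = "\<lambda>l. {\<omega> \<in> space M. \<forall>j<l. T j \<omega> = run_path k y n j}"
  have A: "prob (?A (Suc (?s + l))) = markov_fd mu Q (Suc ?s) (run_path k y n) * Q (y n) (y n) ^ l" for l
    by (simp only: T_fd markov_fd_run_path)
  have E: "?E = ?A (Suc (?s + m)) - ?A (Suc (?s + Suc m))"
    using switchY_hold_pos_iff[OF assms] Suc by auto
  have "prob ?E = prob (?A (Suc (?s + m))) - prob (?A (Suc (?s + Suc m)))"
    unfolding E by (intro finite_measure_Diff) auto
  then have "prob ?E = markov_fd mu Q (Suc ?s) (run_path k y n) * (Q (y n) (y n) ^ m * (1 - Q (y n) (y n)))"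
    unfolding A by (simp add: algebra_simps del: All_less_Suc)
  then show ?thesis
    unfolding pmf_hold Suc using Q_absorbing by simp
next
  case 0
  let ?s = "sum k {..<n}"
  let ?A = "{\<omega> \<in> space M. \<forall>j<Suc ?s. T j \<omega> = run_path k y n j}"
  have E: "?E = {\<omega> \<in> space M. (\<forall>j\<le>?s. T j \<omega> = run_path k y n j) \<and> (\<forall>j\<ge>?s. T j \<omega> = y n)}"
    using switchY_hold_0_iff[OF assms 0] by simp
  have *: "(\<forall>j\<ge>?s. T j \<omega> = y n) \<longleftrightarrow> Q (y n) (y n) = 1"
    if "regular_path (\<lambda>j. T j \<omega>)" "\<forall>j\<le>?s. T j \<omega> = run_path k y n j" for \<omega>
  proof -
    have "T ?s \<omega> = y n" using that(2) run_path_eq[of k n ?s y] by simp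
    then show ?thesis
      using that(1)[unfolded regular_path_def, rule_format, of ?s] by simp
  qed
  have AE: "AE \<omega> in M. \<omega> \<in> ?E \<longleftrightarrow> \<omega> \<in> (if Q (y n) (y n) = 1 then ?A else {})"
    using AE_regular_path
  proof eventually_elim
    case (elim \<omega>)
    show ?case
    proof (cases "\<forall>j\<le>?s. T j \<omega> = run_path k y n j")
      case True
      show ?thesis
        unfolding E unfolding less_Suc_eq_le mem_Collect_eq *[OF elim True]
        by (cases "Q (y n) (y n) = 1") (simp_all only: if_True if_False mem_Collect_eq empty_iff simp_thms)
    next
      case False
      then show ?thesis
        unfolding E unfolding less_Suc_eq_le
        by (cases "Q (y n) (y n) = 1") (simp_all only: if_True if_False mem_Collect_eq empty_iff simp_thms)
    qed
  qed
  have "prob ?E = prob (if Q (y n) (y n) = 1 then ?A else {})"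
  proof (rule measure_eq_AE[OF AE])
    show "(if Q (y n) (y n) = 1 then ?A else {}) \<in> sets M"
      by simp
  qed (rule sets_switchY_hold)
  then show ?thesis
    unfolding pmf_hold using 0 T_fd[of "Suc ?s" "run_path k y n"]
    by (cases "Q (y n) (y n) = 1") (simp_all only: if_True if_False measure_empty mult_1_right mult_zero_right simp_thms)
qed

text \<open>In a word of nonzero weight, an infinite hold or a repeated state occurs only at an
  absorbing state. The jump kernel keeps the word there up to index \<open>m\<close>, where only
  hold \<open>0\<close> has positive weight.\<close>

lemma hold_eq_0_of_repeat:
  assumes "markov_fd mu (KG (clump_generator th Q)) (Suc m) y * (\<Prod>i<Suc m. pmf (hold_pmf (Q (y i) (y i))) (k i)) \<noteq> 0"
    and "i < m" "k i = 0 \<or> y i = y (Suc i)"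
  shows "k m = 0"
proof -
  let ?K = "KG (clump_generator th Q)"
  have K: "?K (y j) (y (Suc j)) \<noteq> 0" if "j < m" for j
  proof -
    have "markov_fd mu ?K (Suc m) y \<noteq> 0"
      using assms(1) by (simp only: mult_eq_0_iff simp_thms de_Morgan_disj)
    then have "(\<Prod>j\<in>{1..<Suc m}. ?K (y (j - 1)) (y j)) \<noteq> 0"
      unfolding markov_fd_def by (simp only: nat.distinct if_False mult_eq_0_iff simp_thms de_Morgan_disj)
    then have "\<forall>j\<in>{1..<Suc m}. ?K (y (j - 1)) (y j) \<noteq> 0"
      by (simp only: prod_zero_iff finite_atLeastLessThan) blast
    then show ?thesis
      using that by (auto dest: bspec[of _ _ "Suc j"])
  qed
  have p: "pmf (hold_pmf (Q (y j) (y j))) (k j) \<noteq> 0" if "j \<le> m" for j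
    using assms(1) that by (simp del: prod.lessThan_Suc add: less_Suc_eq_le)
  have absorbing: "Q (y i) (y i) = 1"
    using assms(3)
  proof
    assume "k i = 0"
    then show ?thesis using p[of i] assms(2) by (simp add: pmf_hold split: if_splits)
  next
    assume "y i = y (Suc i)"
    then show ?thesis using K[of i] assms(2) th by (simp add: KG_def split: if_splits)
  qed
  have "y (i + d) = y i" if "i + d \<le> m" for d
    using that
  proof (induction d)
    case (Suc d)
    then have "y (i + d) = y i" "?K (y (i + d)) (y (Suc (i + d))) \<noteq> 0"
      using K[of "i + d"] by auto
    then show ?case
      using absorbing by (auto simp: KG_def split: if_splits)
  qed simp
  from this[of "m - i"] have "y m = y i"
    using assms(2) by simp
  then have "Q (y m) (y m) = 1"
    using absorbing assms(2) by simp
  then show ?thesis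
    using p[of m] pmf_hold[of "y m" "k m"] by (simp split: if_splits)
qed

text \<open>Since \<open>y\<close> and \<open>k\<close> are arbitrary, words that describe no
  genuine clumps must be covered too: impossible ones, for which both sides vanish, and words
  already absorbed, where the next pair is forced to repeat the state with hold \<open>0\<close>.
  The last kind is why an induction on \<open>n\<close> is used.\<close>

lemma prob_switchY_hold:
  "prob {\<omega> \<in> space M. \<forall>i<n. switchY (\<lambda>j. T j \<omega>) i = y i \<and> hold (\<lambda>j. T j \<omega>) i = k i} =
     markov_fd mu (KG (clump_generator th Q)) n y * (\<Prod>i<n. pmf (hold_pmf (Q (y i) (y i))) (k i))"
proof (induction n)
  case 0
  then show ?case by (simp add: markov_fd_def prob_space)
next
  case (Suc n)
  let ?K = "KG (clump_generator th Q)"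
  let ?R = "\<lambda>n. markov_fd mu ?K n y * (\<Prod>i<n. pmf (hold_pmf (Q (y i) (y i))) (k i))"
  let ?P = "\<lambda>n \<omega>. \<forall>i<n. switchY (\<lambda>j. T j \<omega>) i = y i \<and> hold (\<lambda>j. T j \<omega>) i = k i"
  have R_Suc: "?R (Suc n) = ?R n * (?K (y (n - 1)) (y n) * pmf (hold_pmf (Q (y n) (y n))) (k n))" if "n > 0"
    using that by (simp add: markov_fd_Suc)
  consider (direct) "\<forall>i<n. 0 < k i" "\<forall>i<n. y i \<noteq> y (Suc i)"
    | (null) "n > 0" "?R n = 0"
    | (repeat) m where "n = Suc m" "0 < k m" "y m = y (Suc m)"
    | (absorbed) m where "n = Suc m" "k m = 0" "?R n \<noteq> 0"
  proof (cases n)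
    case (Suc m)
    consider "?R n = 0" | "?R n \<noteq> 0" "k m = 0" | "0 < k m" "y m = y (Suc m)"
      | "?R n \<noteq> 0" "0 < k m" "y m \<noteq> y (Suc m)"
      by auto
    then show thesis
    proof cases
      case 4
      \<comment> \<open>An earlier irregularity in a word of nonzero weight would have forced
        \<open>k m = 0\<close>.\<close>
      have "0 < k i \<and> y i \<noteq> y (Suc i)" if "i < n" for i
      proof (rule ccontr)
        assume "\<not> (0 < k i \<and> y i \<noteq> y (Suc i))"
        then have i: "k i = 0 \<or> y i = y (Suc i)" by auto
        with 4 that Suc have "i < m" by (cases "i = m") auto
        then show False
          using hold_eq_0_of_repeat[OF 4(1)[unfolded Suc] _ i] 4(2) by simp
      qed
      then show thesis using direct by blast
    qed (use Suc null repeat absorbed in auto)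
  qed (use direct in auto)
  then show ?case
  proof cases
    case direct
    then show ?thesis
      using prob_hold_aux[OF direct] markov_fd_run_path_eq[OF direct] by simp
  next
    case null
    have "prob {\<omega> \<in> space M. ?P (Suc n) \<omega>} \<le> prob {\<omega> \<in> space M. ?P n \<omega>}"
      by (intro finite_measure_mono) auto
    also have "\<dots> = 0" using Suc null by simp
    finally show ?thesis
      using R_Suc null by (simp add: measure_le_0_iff)
  next
    case repeat
    have "\<not> ?P (Suc n) \<omega>" for \<omega>
    proof
      assume P: "?P (Suc n) \<omega>"
      have "switchY (\<lambda>j. T j \<omega>) (Suc m) \<noteq> switchY (\<lambda>j. T j \<omega>) m"
        using P repeat by (intro switchY_hold_neq) simp
      then show False
        using P repeat by simp
    qed
    then have "prob {\<omega> \<in> space M. ?P (Suc n) \<omega>} = 0"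
      by (simp only: simp_thms Collect_empty_eq[THEN iffD2] measure_empty)
    \<comment> \<open>A repeated state has nonzero jump weight only if it is absorbing, and then the
      positive hold \<open>k m\<close> has weight \<open>0\<close>.\<close>
    moreover have "?K (y m) (y n) * pmf (hold_pmf (Q (y m) (y m))) (k m) = 0"
      unfolding pmf_hold using repeat th by (simp add: KG_def)
    then have "?R (Suc n) = 0"
      using repeat by (auto simp: markov_fd_Suc)
    ultimately show ?thesis
      by (simp only:)
  next
    case absorbed
    have "pmf (hold_pmf (Q (y m) (y m))) (k m) \<noteq> 0"
      using absorbed by simp
    then have Q1: "Q (y m) (y m) = 1"
      unfolding pmf_hold using absorbed by (simp split: if_splits)
    \<comment> \<open>After absorption the next pair is almost surely determined, so the extended
      event is either the previous one or null.\<close>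
    let ?A = "if y n = y m \<and> k n = 0 then {\<omega> \<in> space M. ?P n \<omega>} else {}"
    have AE: "AE \<omega> in M. \<omega> \<in> {\<omega> \<in> space M. ?P (Suc n) \<omega>} \<longleftrightarrow> \<omega> \<in> ?A"
      using AE_regular_path
    proof eventually_elim
      case (elim \<omega>)
      let ?t = "\<lambda>j. T j \<omega>"
      have n: "switchY ?t n = y m \<and> hold ?t n = 0" if P: "?P n \<omega>"
      proof -
        have m: "switchY ?t m = y m" "hold ?t m = 0"
          using P absorbed by simp_all
        then have "switchY ?t n = y m"
          unfolding hold_eq_0_iff absorbed(1) by (simp add: switchY_Suc_infinity)
        then show ?thesis
          using hold_eq_0_iff_absorbing[OF elim, of n] Q1 by simp
      qed
      show ?case
      proof (cases "?P n \<omega>")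
        case True
        with n[OF True] show ?thesis
          by (auto simp: All_less_Suc)
      next
        case False
        then show ?thesis
          unfolding All_less_Suc by (split if_split) blast
      qed
    qed
    have "prob {\<omega> \<in> space M. ?P (Suc n) \<omega>} = prob ?A"
    proof (rule measure_eq_AE[OF AE])
      show "?A \<in> sets M"
        using sets_switchY_hold[of n y k] by simp
    qed (rule sets_switchY_hold)
    also have "\<dots> = ?R n * (if y n = y m \<and> k n = 0 then 1 else 0)"
      using Suc by simp
    also have "(if y n = y m \<and> k n = 0 then 1 else 0) = ?K (y m) (y n) * pmf (hold_pmf (Q (y n) (y n))) (k n)"
      unfolding pmf_hold using Q1 by (auto simp: KG_def)
    finally show ?thesis
      using R_Suc absorbed(1) by (simp only: diff_Suc_1 zero_less_Suc simp_thms)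
  qed
qed

end

section \<open>Clump fractions\<close>

lemma switch_eq_sum_hold: "switch t j = enat u \<Longrightarrow> u = sum (hold t) {..<j}"
proof (induction j arbitrary: u)
  case (Suc j)
  then obtain u' where "u' < u" "switch t j = enat u'"
    unfolding switch_Suc_eq_enat_iff by blast
  with Suc show ?case
    by (simp add: hold_def)
qed (simp add: enat_0_iff)

text \<open>An empty product would give the fraction \<open>0\<close>; the value \<open>1\<close>
  for \<open>k = 0\<close> instead lets an infinite clump take everything that remains.\<close>

definition block_fraction :: "(nat \<Rightarrow> real) \<Rightarrow> nat \<Rightarrow> nat \<Rightarrow> real" where
  "block_fraction x s k = (if k = 0 then 1 else 1 - (\<Prod>i\<in>{s..<s + k}. 1 - x i))"

text \<open>The start of the block is a sum of holds rather than a switch time, so it stays finite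
  after absorption and is known once the holds are fixed.\<close>

definition clump_fraction :: "(nat \<Rightarrow> real) \<Rightarrow> (nat \<Rightarrow> 'x) \<Rightarrow> nat \<Rightarrow> real" where
  "clump_fraction x t j = block_fraction x (sum (hold t) {..<j}) (hold t j)"

lemma sum_RAM: "(\<Sum>i<n. RAM x i) = 1 - (\<Prod>i<n. 1 - x i)"
  by (induction n) (simp_all add: RAM_def algebra_simps)

lemma sum_RAM_ivl:
  assumes "u \<le> v"
  shows "(\<Sum>i=u..<v. RAM x i) = (\<Prod>i<u. 1 - x i) - (\<Prod>i<v. 1 - x i)"
  using assms sum_diff_nat_ivl[of 0 u v "RAM x"] sum_RAM[of x u] sum_RAM[of x v]
  by (simp add: atLeast0LessThan)

lemma prod_clump_fraction:
  "switch t j = enat u \<Longrightarrow> (\<Prod>i<j. 1 - clump_fraction x t i) = (\<Prod>i<u. 1 - x i)"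
proof (induction j arbitrary: u)
  case 0
  then show ?case by (simp add: enat_0_iff)
next
  case (Suc j)
  then obtain s where s: "s < u" "switch t j = enat s"
    unfolding switch_Suc_eq_enat_iff by blast
  have "hold t j = u - s"
    using s Suc.prems by (simp add: hold_def)
  then have "1 - clump_fraction x t j = (\<Prod>i\<in>{s..<u}. 1 - x i)"
    using s(1) switch_eq_sum_hold[OF s(2)] by (simp add: clump_fraction_def block_fraction_def)
  moreover have "{..<u} = {..<s} \<union> {s..<u}" using s(1) by auto
  then have "(\<Prod>i<u. 1 - x i) = (\<Prod>i<s. 1 - x i) * (\<Prod>i\<in>{s..<u}. 1 - x i)"
    by (simp add: prod.union_disjoint ivl_disj_int)
  ultimately show ?case
    using Suc.IH[OF s(2)] by simp
qed

lemma prod_clump_fraction_infinity: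
  assumes "switch t j = \<infinity>"
  shows "(\<Prod>i<j. 1 - clump_fraction x t i) = 0"
proof -
  obtain i where "i < j" "hold t i = 0"
    using assms by (cases j) (auto simp: hold_eq_0_iff)
  then have "1 - clump_fraction x t i = 0" "i \<in> {..<j}"
    by (simp_all add: clump_fraction_def block_fraction_def)
  then show ?thesis
    by (intro prod_zero) auto
qed

text \<open>Both sides are differences of the mass left before and after the clump, by telescoping.
  The limit matters for an infinite clump: its series sums to the whole remaining mass because the
  leftover tends to \<open>0\<close>.\<close>

lemma clumped_eq_RAM_clump_fraction:
  assumes lim: "(\<lambda>n. \<Prod>i<n. 1 - x i) \<longlonglongrightarrow> 0"
  shows "clumped (switch t) (RAM x) = RAM (clump_fraction x t)"
proof
  fix j
  show "clumped (switch t) (RAM x) j = RAM (clump_fraction x t) j"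
  proof (cases "switch t j")
    case infinity
    then show ?thesis
      unfolding RAM_def[of "clump_fraction x t"] prod_clump_fraction_infinity[OF infinity]
      by (simp add: clumped_def)
  next
    case (enat u)
    note prod = prod_clump_fraction[OF enat] and s = switch_eq_sum_hold[OF enat]
    show ?thesis
    proof (cases "switch t (Suc j)")
      case (enat v)
      then have "u < v"
        using \<open>switch t j = enat u\<close> unfolding switch_Suc_eq_enat_iff by auto
      have "clumped (switch t) (RAM x) j = (\<Sum>i\<in>{u..<v}. RAM x i)"
        unfolding clumped_def \<open>switch t j = enat u\<close> enat
        by (subst suminf_finite[of "{u..<v}"]) auto
      also have "\<dots> = (\<Prod>i<j. 1 - clump_fraction x t i) - (\<Prod>i<Suc j. 1 - clump_fraction x t i)"
        unfolding prod prod_clump_fraction[OF enat] using \<open>u < v\<close> by (intro sum_RAM_ivl) simp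
      also have "\<dots> = RAM (clump_fraction x t) j"
        by (simp add: RAM_def algebra_simps)
      finally show ?thesis .
    next
      case infinity
      have "(\<lambda>i. if u \<le> i then RAM x i else 0) sums (\<Prod>i<u. 1 - x i)"
        unfolding sums_def
      proof (rule Lim_transform_eventually)
        show "(\<lambda>n. (\<Prod>i<u. 1 - x i) - (\<Prod>i<n. 1 - x i)) \<longlonglongrightarrow> (\<Prod>i<u. 1 - x i)"
          using tendsto_diff[OF tendsto_const lim] by simp
        show "\<forall>\<^sub>F n in sequentially. (\<Prod>i<u. 1 - x i) - (\<Prod>i<n. 1 - x i) = (\<Sum>i<n. if u \<le> i then RAM x i else 0)"
          using eventually_ge_at_top[of u]
        proof eventually_elim
          case (elim n)
          have "(\<Sum>i<n. if u \<le> i then RAM x i else 0) = (\<Sum>i\<in>{u..<n}. RAM x i)"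
            by (rule sum.mono_neutral_cong_right) auto
          then show ?case
            using sum_RAM_ivl[OF elim] by simp
        qed
      qed
      then have "clumped (switch t) (RAM x) j = (\<Prod>i<u. 1 - x i)"
        unfolding clumped_def \<open>switch t j = enat u\<close> infinity by (simp add: sums_iff)
      moreover have "clump_fraction x t j = 1"
        using infinity by (simp add: clump_fraction_def block_fraction_def flip: hold_eq_0_iff)
      ultimately show ?thesis
        by (simp add: RAM_def prod)
    qed
  qed
qed

section \<open>Exhaustion of the unit mass and independence of blocks\<close>

lemma (in prob_space) AE_prod_tendsto_0:
  assumes th: "0 < th" and indep: "indep_vars (\<lambda>_. borel) X UNIV"
    and X: "\<And>j::nat. distr M borel (X j) = beta1 th"
  shows "AE \<omega> in M. (\<lambda>n. \<Prod>i<n. 1 - X i \<omega>) \<longlonglongrightarrow> 0"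
proof -
  have [measurable]: "X j \<in> borel_measurable M" for j
    using indep by (auto simp: indep_vars_def)
  have lt: "AE \<omega> in M. X j \<omega> < 1" for j
    using AE_beta1[OF th] unfolding X[of j, symmetric]
    by (subst (asm) AE_distr_iff) auto
  have r: "(\<integral>\<^sup>+\<omega>. ennreal (1 - X j \<omega>) \<partial>M) = ennreal (th / (th + 1))" for j
    unfolding nn_integral_beta1_diff[OF th, symmetric] X[of j, symmetric]
    by (subst nn_integral_distr) auto
  have "indep_vars (\<lambda>_. borel) (\<lambda>j \<omega>. ennreal (1 - X j \<omega>)) UNIV"
    by (rule indep_vars_compose2[OF indep]) auto
  \<comment> \<open>The expected leftovers form a convergent geometric series. Their random series
    is therefore finite almost surely, which forces its terms to \<open>0\<close>.\<close>
  then have "(\<integral>\<^sup>+\<omega>. (\<Prod>i<n. ennreal (1 - X i \<omega>)) \<partial>M) = ennreal ((th / (th + 1)) ^ n)" for n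
    using th by (subst indep_vars_nn_integral) (auto simp: r ennreal_power intro: indep_vars_subset)
  then have "(\<integral>\<^sup>+\<omega>. (\<Sum>n. \<Prod>i<n. ennreal (1 - X i \<omega>)) \<partial>M) = (\<Sum>n. ennreal ((th / (th + 1)) ^ n))"
    by (subst nn_integral_suminf) auto
  also have "\<dots> \<noteq> \<infinity>"
    using th by (subst suminf_ennreal2) (auto intro!: summable_geometric)
  finally have "AE \<omega> in M. (\<Sum>n. \<Prod>i<n. ennreal (1 - X i \<omega>)) \<noteq> \<infinity>"
    by (intro nn_integral_PInf_AE) auto
  moreover have "AE \<omega> in M. \<forall>j. X j \<omega> < 1"
    using lt by (simp add: AE_all_countable)
  ultimately show ?thesis
  proof eventually_elim
    case (elim \<omega>)
    have "(\<Prod>i<n. ennreal (1 - X i \<omega>)) = ennreal (\<Prod>i<n. 1 - X i \<omega>)" for n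
      using elim(2) by (intro prod_ennreal) (simp add: less_imp_le)
    then have "summable (\<lambda>n. \<Prod>i<n. 1 - X i \<omega>)"
      using elim by (intro summable_suminf_not_top) (auto intro!: prod_nonneg simp: less_imp_le)
    then show ?case
      by (rule summable_LIMSEQ_zero)
  qed
qed

lemma measurable_sum_hold:
  "(\<lambda>t. sum (hold t) {..<j}) \<in> measurable (seqX :: (nat \<Rightarrow> 'x::countable) measure) (count_space UNIV)"
proof (induction j)
  case (Suc j)
  show ?case
    unfolding sum.lessThan_Suc
    by (rule measurable_compose_countable[OF _ Suc],
        rule measurable_compose[OF measurable_hold]) simp
qed simp

text \<open>For deterministic \<open>k\<close> the blocks use disjoint sets of sticks, so their
  fractions are independent. A hold \<open>0\<close> corresponds to an empty set of sticks and a
  constant fraction, which does no harm to independence.\<close>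

lemma (in prob_space) prob_block_fractions:
  fixes X :: "nat \<Rightarrow> 'a \<Rightarrow> real" and n :: nat
  assumes th: "0 < th" and indep: "indep_vars (\<lambda>_. borel) X UNIV"
    and X: "\<And>j. distr M borel (X j) = beta1 th"
    and B: "\<And>i. i < n \<Longrightarrow> B i \<in> sets borel"
  shows "prob {\<omega> \<in> space M. \<forall>i<n. block_fraction (\<lambda>j. X j \<omega>) (sum k {..<i}) (k i) \<in> B i} =
    (\<Prod>i<n. measure (block_law th (k i)) (B i))"
proof (cases "n = 0")
  case True
  then show ?thesis by (simp add: prob_space)
next
  case False
  have X_meas [measurable]: "X j \<in> borel_measurable M" for j
    using indep by (auto simp: indep_vars_def)
  define K where "K = (\<lambda>i. {sum k {..<i}..<sum k {..<i} + k i})"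
  define W where "W = (\<lambda>i \<omega>. block_fraction (\<lambda>j. X j \<omega>) (sum k {..<i}) (k i))"
  \<comment> \<open>\<open>F i\<close> reads the sticks of block \<open>i\<close> only, so
    \<open>W i\<close> factors through their restriction to \<open>K i\<close>.\<close>
  define F where "F = (\<lambda>i f. if k i = 0 then 1 else 1 - (\<Prod>j\<in>K i. 1 - f j :: real))"
  have sum_le: "sum k {..<i} + k i \<le> sum k {..<j}" if "i < j" for i j
    using that sum_mono2[of "{..<j}" "{..<Suc i}" k] by auto
  have "disjoint_family_on K {..<n}"
    unfolding disjoint_family_on_def
  proof (intro ballI impI)
    fix i j :: nat assume "i \<noteq> j"
    then show "K i \<inter> K j = {}"
      using sum_le[of i j] sum_le[of j i] by (cases "i < j") (auto simp: K_def)
  qed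
  then have "indep_vars (\<lambda>i. PiM (K i) (\<lambda>_. borel)) (\<lambda>i \<omega>. restrict (\<lambda>j. X j \<omega>) (K i)) {..<n}"
    by (intro indep_vars_restrict[OF indep]) auto
  then have "indep_vars (\<lambda>_. borel) (\<lambda>i \<omega>. F i (restrict (\<lambda>j. X j \<omega>) (K i))) {..<n}"
    by (rule indep_vars_compose2) (auto simp: F_def K_def)
  moreover have "F i (restrict (\<lambda>j. X j \<omega>) (K i)) = W i \<omega>" for i \<omega>
    by (simp add: F_def W_def block_fraction_def K_def)
  ultimately have indep_W: "indep_vars (\<lambda>_. borel) W {..<n}"
    by (simp add: W_def)
  have W_meas [measurable]: "W i \<in> borel_measurable M" for i
    unfolding W_def block_fraction_def by measurable
  have W_distr: "distr M borel (W i) = block_law th (k i)" for i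
  proof (cases "k i = 0")
    case True
    then show ?thesis
      by (simp add: W_def block_fraction_def block_law_def )
  next
    case False
    then show ?thesis
      using distr_block_law[of "K i" th X] th X indep_vars_subset[OF indep, of "K i"]
      by (simp add: W_def block_fraction_def K_def)
  qed
  have eq: "{\<omega> \<in> space M. \<forall>i<n. W i \<omega> \<in> B i} = (\<Inter>i\<in>{..<n}. W i -` B i \<inter> space M)"
    using False by auto
  have "prob {\<omega> \<in> space M. \<forall>i<n. W i \<omega> \<in> B i} = (\<Prod>i<n. prob (W i -` B i \<inter> space M))"
    unfolding eq by (rule indep_varsD_finite[OF indep_W]) (use False B in \<open>auto simp: lessThan_empty_iff\<close>)
  also have "\<dots> = (\<Prod>i<n. measure (block_law th (k i)) (B i))"
    by (intro prod.cong refl) (simp add: measure_distr B flip: W_distr)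
  finally show ?thesis
    by (simp only: W_def)
qed

lemma prob_space_block_law: "0 < th \<Longrightarrow> prob_space (block_law th k)"
  by (auto simp: block_law_def prob_space_return
      intro!: prob_space.prob_space_distr prob_space_erlang_density)

section \<open>Summing out the holding times\<close>

locale clumped_GEM = chain_on_paths M T Q mu th
  for M :: "'a measure" and T :: "nat \<Rightarrow> 'a \<Rightarrow> 'x::countable"
    and Q :: "'x \<Rightarrow> 'x \<Rightarrow> real" and mu :: "'x pmf" and th :: real +
  fixes X :: "nat \<Rightarrow> 'a \<Rightarrow> real"
  assumes X_indep: "indep_vars (\<lambda>_. borel) X UNIV"
    and X_distr: "\<And>j. distr M borel (X j) = beta1 th"
    and X_T_indep: "distr M (seqR \<Otimes>\<^sub>M seqX) (\<lambda>\<omega>. (\<lambda>j. X j \<omega>, \<lambda>j. T j \<omega>))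
         = distr M seqR (\<lambda>\<omega> j. X j \<omega>) \<Otimes>\<^sub>M distr M seqX (\<lambda>\<omega> j. T j \<omega>)"
begin

lemma X_measurable [measurable]: "X j \<in> borel_measurable M"
  using X_indep by (auto simp: indep_vars_def)

lemma X_seq_measurable [measurable]: "(\<lambda>\<omega> j. X j \<omega>) \<in> measurable M seqR"
  by (intro measurable_abs_UNIV X_measurable)

lemma prob_X_T:
  assumes C: "C \<in> sets seqR" and A: "A \<in> sets seqX"
  shows "prob {\<omega> \<in> space M. (\<lambda>j. X j \<omega>) \<in> C \<and> (\<lambda>j. T j \<omega>) \<in> A} =
    prob {\<omega> \<in> space M. (\<lambda>j. X j \<omega>) \<in> C} * prob {\<omega> \<in> space M. (\<lambda>j. T j \<omega>) \<in> A}"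
proof -
  interpret PX: prob_space "distr M seqR (\<lambda>\<omega> j. X j \<omega>)"
    by (rule prob_space_distr) (rule X_seq_measurable)
  interpret PT: prob_space "distr M seqX (\<lambda>\<omega> j. T j \<omega>)"
    by (rule prob_space_distr) (rule T_seq_measurable)
  let ?XT = "\<lambda>\<omega>. (\<lambda>j. X j \<omega>, \<lambda>j. T j \<omega>)"
  have "measure (distr M (seqR \<Otimes>\<^sub>M seqX) ?XT) (C \<times> A) =
      measure (distr M seqR (\<lambda>\<omega> j. X j \<omega>)) C * measure (distr M seqX (\<lambda>\<omega> j. T j \<omega>)) A"
    unfolding X_T_indep using C A
    by (simp add: measure_def PT.emeasure_pair_measure_Times enn2real_mult)
  moreover have "?XT \<in> measurable M (seqR \<Otimes>\<^sub>M seqX)"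
    by (intro measurable_Pair X_seq_measurable T_seq_measurable)
  ultimately show ?thesis
    using C A by (simp add: measure_distr vimage_def Int_def conj_commute)
qed

text \<open>With the holds fixed to \<open>k\<close>, the condition on the fractions concerns
  \<open>X\<close> alone and the other one concerns \<open>T\<close> alone, so the independence of
  the two sequences splits the probability.\<close>

lemma prob_clump_block:
  fixes y :: "nat \<Rightarrow> 'x" and k :: "nat \<Rightarrow> nat"
  assumes B: "\<And>i. i < n \<Longrightarrow> B i \<in> sets borel"
  defines "E \<equiv> {\<omega> \<in> space M. (\<forall>i<n. block_fraction (\<lambda>j. X j \<omega>) (sum k {..<i}) (k i) \<in> B i) \<and>
       (\<forall>i<n. switchY (\<lambda>j. T j \<omega>) i = y i \<and> hold (\<lambda>j. T j \<omega>) i = k i)}"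
  shows "E \<in> sets M"
    and "prob E = (\<Prod>i<n. measure (block_law th (k i)) (B i)) *
    (markov_fd mu (KG (clump_generator th Q)) n y * (\<Prod>i<n. pmf (hold_pmf (Q (y i) (y i))) (k i)))"
proof -
  have meas: "(\<lambda>x. block_fraction x s l) \<in> borel_measurable seqR" for s l
    unfolding block_fraction_def by measurable
  define C where "C = {x \<in> space seqR. \<forall>i\<in>{..<n}. block_fraction x (sum k {..<i}) (k i) \<in> B i}"
  define A where "A = {t \<in> space seqX. \<forall>i<n. switchY t i = y i \<and> hold t i = k i}"
  have C: "C \<in> sets seqR"
    unfolding C_def
    by (intro sets.sets_Collect_finite_All measurable_sets_Collect[OF meas]) (use B in auto)
  have A: "A \<in> sets seqX"
    unfolding A_def by measurable
  have E: "E = {\<omega> \<in> space M. (\<lambda>j. X j \<omega>) \<in> C \<and> (\<lambda>j. T j \<omega>) \<in> A}"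
    by (auto simp: E_def C_def A_def space_PiM)
  show "E \<in> sets M"
    unfolding E
    by (intro sets.sets_Collect_conj measurable_sets_Collect[OF X_seq_measurable]
        measurable_sets_Collect[OF T_seq_measurable])
       (simp_all add: Collect_conj_eq sets.Int_space_eq1 C A)
  have "prob {\<omega> \<in> space M. (\<lambda>j. X j \<omega>) \<in> C} = (\<Prod>i<n. measure (block_law th (k i)) (B i))"
    using prob_block_fractions[where n = n and k = k and B = B, OF th X_indep X_distr B] by (simp add: C_def space_PiM Ball_def)
  moreover have "prob {\<omega> \<in> space M. (\<lambda>j. T j \<omega>) \<in> A} =
      markov_fd mu (KG (clump_generator th Q)) n y * (\<Prod>i<n. pmf (hold_pmf (Q (y i) (y i))) (k i))"
    using prob_switchY_hold[of n y k] by (simp add: A_def space_PiM)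
  ultimately show "prob E = (\<Prod>i<n. measure (block_law th (k i)) (B i)) *
    (markov_fd mu (KG (clump_generator th Q)) n y * (\<Prod>i<n. pmf (hold_pmf (Q (y i) (y i))) (k i)))"
    unfolding E prob_X_T[OF C A] by simp
qed

lemma markov_fd_KG_nonneg: "0 \<le> markov_fd mu (KG (clump_generator th Q)) n y"
proof -
  have "0 \<le> KG (clump_generator th Q) w z" for w z
  proof -
    have "0 \<le> th * Q w z / (- (th * (Q w w - 1)))"
      using th Q_nonneg[of w z] Q_le_1[of w]
      by (intro divide_nonneg_nonneg) (auto simp: mult_nonneg_nonpos)
    then show ?thesis by (auto simp: KG_def)
  qed
  then show ?thesis
    by (simp add: markov_fd_def prod_nonneg)
qed

text \<open>The hold weights are those of the product law \<open>Pi_pmf\<close>, so the sum over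
  hold vectors is an expectation of a product of functions of independent coordinates, and each
  factor is a geometric mixture. Working in \<open>ennreal\<close> avoids questions of
  summability.\<close>

lemma emeasure_clump_fractions:
  assumes B: "\<And>i. i < n \<Longrightarrow> B i \<in> sets borel"
  shows "emeasure M {\<omega> \<in> space M. \<forall>i<n. switchY (\<lambda>j. T j \<omega>) i = y i \<and>
        clump_fraction (\<lambda>j. X j \<omega>) (\<lambda>j. T j \<omega>) i \<in> B i} =
    ennreal (markov_fd mu (KG (clump_generator th Q)) n y) *
      (\<Prod>i<n. emeasure (beta1 (th * (1 - Q (y i) (y i)))) (B i))"
proof -
  let ?c = "markov_fd mu (KG (clump_generator th Q)) n y"
  define p where "p = (\<lambda>i. hold_pmf (Q (y i) (y i)))"
  define E where "E = (\<lambda>k. {\<omega> \<in> space M. (\<forall>i<n. block_fraction (\<lambda>j. X j \<omega>) (sum k {..<i}) (k i) \<in> B i) \<and>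
       (\<forall>i<n. switchY (\<lambda>j. T j \<omega>) i = y i \<and> hold (\<lambda>j. T j \<omega>) i = k i)})"
  \<comment> \<open>Vectors extended by the default \<open>0\<close> from \<open>n\<close> on: each
    hold vector of length \<open>n\<close> occurs once, which makes the events disjoint and the
    index set countable, and \<open>Pi_pmf\<close> vanishes outside.\<close>
  define I :: "(nat \<Rightarrow> nat) set" where "I = {k. \<forall>i. i \<notin> {..<n} \<longrightarrow> k i = 0}"
  have c_nonneg: "0 \<le> ?c"
    by (rule markov_fd_KG_nonneg)
  have "I \<subseteq> range (\<lambda>l i. if i < length l then l ! i else 0)"
  proof
    fix k assume "k \<in> I"
    then have "k = (\<lambda>i. if i < length (map k [0..<n]) then map k [0..<n] ! i else 0)"
      by (auto simp: I_def)
    then show "k \<in> range (\<lambda>l i. if i < length l then l ! i else 0)"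
      by blast
  qed
  then have "countable I"
    by (rule countable_subset) simp
  have "{\<omega> \<in> space M. \<forall>i<n. switchY (\<lambda>j. T j \<omega>) i = y i \<and>
        clump_fraction (\<lambda>j. X j \<omega>) (\<lambda>j. T j \<omega>) i \<in> B i} = (\<Union>k\<in>I. E k)" (is "?L = ?R")
  proof
    show "?L \<subseteq> ?R"
    proof
      fix \<omega> assume \<omega>: "\<omega> \<in> ?L"
      define k where "k = (\<lambda>i. if i < n then hold (\<lambda>j. T j \<omega>) i else 0)"
      have "sum k {..<i} = sum (hold (\<lambda>j. T j \<omega>)) {..<i}" if "i < n" for i
        using that by (intro sum.cong) (auto simp: k_def)
      then have "\<omega> \<in> E k"
        using \<omega> by (simp add: E_def clump_fraction_def) (simp add: k_def)
      moreover have "k \<in> I" by (simp add: I_def k_def)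
      ultimately show "\<omega> \<in> ?R" by blast
    qed
    show "?R \<subseteq> ?L"
    proof
      fix \<omega> assume "\<omega> \<in> ?R"
      then obtain k where \<omega>: "\<omega> \<in> E k" by blast
      then have "sum (hold (\<lambda>j. T j \<omega>)) {..<i} = sum k {..<i}" if "i < n" for i
        using that by (intro sum.cong) (auto simp: E_def)
      then show "\<omega> \<in> ?L"
        using \<omega> by (simp add: E_def clump_fraction_def)
    qed
  qed
  moreover have "emeasure M (\<Union>k\<in>I. E k) = (\<integral>\<^sup>+k. emeasure M (E k) \<partial>count_space I)"
  proof (rule emeasure_UN_countable)
    show "E k \<in> sets M" for k
      unfolding E_def by (intro prob_clump_block(1) B)
    show "disjoint_family_on E I"
      unfolding disjoint_family_on_def
    proof (intro ballI impI)
      fix k k' assume "k \<in> I" "k' \<in> I" "k \<noteq> k'"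
      then obtain i where "i < n" "k i \<noteq> k' i"
        unfolding I_def by (auto simp: fun_eq_iff) metis
      then show "E k \<inter> E k' = {}"
        by (auto simp: E_def)
    qed
  qed fact
  moreover have "\<dots> = (\<integral>\<^sup>+k. ennreal (pmf (Pi_pmf {..<n} 0 p) k) *
      (ennreal ?c * (\<Prod>i<n. emeasure (block_law th (k i)) (B i))) \<partial>count_space UNIV)"
  proof (subst nn_integral_count_space_indicator, simp, rule nn_integral_cong)
    fix k
    show "emeasure M (E k) * indicator I k = ennreal (pmf (Pi_pmf {..<n} 0 p) k) *
      (ennreal ?c * (\<Prod>i<n. emeasure (block_law th (k i)) (B i)))"
    proof (cases "k \<in> I")
      case True
      then have pmf_k: "pmf (Pi_pmf {..<n} 0 p) k = (\<Prod>i<n. pmf (p i) (k i))"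
        by (intro pmf_Pi') (auto simp: I_def)
      have "emeasure M (E k) = ennreal ((\<Prod>i<n. measure (block_law th (k i)) (B i)) *
         (?c * (\<Prod>i<n. pmf (p i) (k i))))"
        unfolding emeasure_eq_measure E_def p_def by (subst prob_clump_block(2)[OF B]) simp_all
      also have "\<dots> = ennreal (\<Prod>i<n. measure (block_law th (k i)) (B i)) *
         (ennreal ?c * ennreal (pmf (Pi_pmf {..<n} 0 p) k))"
        using c_nonneg by (simp add: pmf_k ennreal_mult prod_nonneg)
      also have "ennreal (\<Prod>i<n. measure (block_law th (k i)) (B i)) =
          (\<Prod>i<n. emeasure (block_law th (k i)) (B i))"
        by (simp add: prod_ennreal finite_measure.emeasure_eq_measure
            prob_space.finite_measure prob_space_block_law th)
      finally show ?thesis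
        using True by (simp add: mult_ac)
    next
      case False
      then have "pmf (Pi_pmf {..<n} 0 p) k = 0"
        by (intro pmf_Pi_outside) (auto simp: I_def)
      then show ?thesis using False by simp
    qed
  qed
  moreover have "\<dots> = ennreal ?c * (\<integral>\<^sup>+k. (\<Prod>i<n. emeasure (block_law th (k i)) (B i)) \<partial>Pi_pmf {..<n} 0 p)"
    unfolding nn_integral_measure_pmf[symmetric] by (rule nn_integral_cmult) simp
  moreover have "\<dots> = ennreal ?c * (\<Prod>i<n. emeasure (beta1 (th * (1 - Q (y i) (y i)))) (B i))"
    using B th nn_integral_prod_Pi_pmf[where A = "{..<n}" and f = "\<lambda>i l. emeasure (block_law th l) (B i)"]
    by (simp add: p_def nn_integral_block_law Q_nonneg Q_le_1)
  ultimately show ?thesis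
    by (simp only:)
qed

section \<open>Measurability and the joint law\<close>

lemma measurable_clump_fraction:
  "(\<lambda>\<omega>. clump_fraction (\<lambda>j. X j \<omega>) (\<lambda>j. T j \<omega>) i) \<in> borel_measurable M"
  unfolding clump_fraction_def
\<comment> \<open>The start and the length of a block are random with countably many values, so they
  are frozen one after the other.\<close>
proof (rule measurable_compose_countable[OF _ measurable_compose[OF T_seq_measurable measurable_sum_hold]])
  fix s
  show "(\<lambda>\<omega>. block_fraction (\<lambda>j. X j \<omega>) s (hold (\<lambda>j. T j \<omega>) i)) \<in> borel_measurable M"
    by (rule measurable_compose_countable[OF _ measurable_compose[OF T_seq_measurable measurable_hold]])
       (simp add: block_fraction_def)
qed

lemma measurable_RAM [measurable]: "RAM \<in> measurable seqR seqR"
proof -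
  have "(\<lambda>x j. RAM x j) \<in> measurable seqR seqR"
    unfolding RAM_def by (intro measurable_abs_UNIV) measurable
  then show ?thesis by simp
qed

lemma measurable_clumped:
  "(\<lambda>\<omega>. clumped (switch (\<lambda>j. T j \<omega>)) (RAM (\<lambda>j. X j \<omega>)) i) \<in> borel_measurable M"
proof -
  define S where "S = (\<lambda>u v \<omega>. if u = \<infinity> then 0
    else \<Sum>l. if u \<le> enat l \<and> enat l < v then RAM (\<lambda>j. X j \<omega>) l else 0)"
  have [measurable]: "(\<lambda>\<omega>. RAM (\<lambda>j. X j \<omega>) l) \<in> borel_measurable M" for l
    unfolding RAM_def by measurable
  have S: "S u v \<in> borel_measurable M" for u v
  proof -
    have "(\<lambda>\<omega>. \<Sum>l. if u \<le> enat l \<and> enat l < v then RAM (\<lambda>j. X j \<omega>) l else 0) \<in> borel_measurable M"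
      by (intro borel_measurable_suminf) auto
    then show ?thesis
      unfolding S_def by (cases "u = \<infinity>") simp_all
  qed
  have sw: "(\<lambda>\<omega>. switch (\<lambda>j. T j \<omega>) i) \<in> measurable M (count_space UNIV)" for i
    by (rule measurable_compose[OF T_seq_measurable measurable_switch])
  have "(\<lambda>\<omega>. S (switch (\<lambda>j. T j \<omega>) i) (switch (\<lambda>j. T j \<omega>) (Suc i)) \<omega>) \<in> borel_measurable M"
    by (rule measurable_compose_countable[where f = "\<lambda>u \<omega>. S u (switch (\<lambda>j. T j \<omega>) (Suc i)) \<omega>", OF _ sw],
        rule measurable_compose_countable[where f = "\<lambda>v. S u v" for u, OF S sw])
  then show ?thesis
    by (simp add: S_def clumped_def)
qed

lemma is_MCcGEM_clumped:
  "is_MCcGEM mu (clump_generator th Q) (distr M (seqR \<Otimes>\<^sub>M seqX)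
     (\<lambda>\<omega>. (clumped (switch (\<lambda>j. T j \<omega>)) (RAM (\<lambda>j. X j \<omega>)), switchY (\<lambda>j. T j \<omega>))))"
proof -
  let ?X = "\<lambda>\<omega> j. X j \<omega>" and ?T = "\<lambda>\<omega> j. T j \<omega>"
  let ?WY = "\<lambda>\<omega>. (clump_fraction (?X \<omega>) (?T \<omega>), switchY (?T \<omega>))"
  \<comment> \<open>The law required by \<open>is_MCcGEM\<close> is that of the clump fractions with
    the visited states; the clumped masses are recovered from it by \<open>RAM\<close>.\<close>
  define L where "L = distr M (seqR \<Otimes>\<^sub>M seqX) ?WY"
  have W: "(\<lambda>\<omega>. clump_fraction (?X \<omega>) (?T \<omega>)) \<in> measurable M seqR"
    using measurable_abs_UNIV[where f = "\<lambda>i \<omega>. clump_fraction (?X \<omega>) (?T \<omega>) i", OF measurable_clump_fraction]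
    by simp
  have P: "(\<lambda>\<omega>. clumped (switch (?T \<omega>)) (RAM (?X \<omega>))) \<in> measurable M seqR"
    using measurable_abs_UNIV[where f = "\<lambda>i \<omega>. clumped (switch (?T \<omega>)) (RAM (?X \<omega>)) i", OF measurable_clumped]
    by simp
  have Y: "(\<lambda>\<omega>. switchY (?T \<omega>)) \<in> measurable M seqX"
    using measurable_abs_UNIV[where f = "\<lambda>i \<omega>. switchY (?T \<omega>) i",
        OF measurable_compose[OF T_seq_measurable measurable_switchY]]
    by simp
  have WY: "?WY \<in> measurable M (seqR \<Otimes>\<^sub>M seqX)"
    by (intro measurable_Pair W Y)
  have R: "(\<lambda>xy. (RAM (fst xy), snd xy)) \<in> measurable (seqR \<Otimes>\<^sub>M seqX) (seqR \<Otimes>\<^sub>M (seqX :: (nat \<Rightarrow> 'x) measure))"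
    by (intro measurable_Pair measurable_compose[OF measurable_fst measurable_RAM] measurable_snd)
  have fdd: "measure L {xy \<in> space L. \<forall>i<n. snd xy i = y i \<and> fst xy i \<in> B i} =
     markov_fd mu (KG (clump_generator th Q)) n y *
     (\<Prod>i<n. measure (beta1 (- (th * (Q (y i) (y i) - (if y i = y i then 1 else 0))))) (B i))"
    if B: "\<forall>i<n. B i \<in> sets borel" for n y B
  proof -
    let ?S = "{xy \<in> space (seqR \<Otimes>\<^sub>M (seqX :: (nat \<Rightarrow> 'x) measure)). \<forall>i\<in>{..<n}. snd xy i = y i \<and> fst xy i \<in> B i}"
    let ?D = "{\<omega> \<in> space M. \<forall>i<n. switchY (?T \<omega>) i = y i \<and> clump_fraction (?X \<omega>) (?T \<omega>) i \<in> B i}"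
    have "?S \<in> sets (seqR \<Otimes>\<^sub>M seqX)"
    proof (intro sets.sets_Collect_finite_All sets.sets_Collect_conj)
      fix i assume "i \<in> {..<n}"
      then have "B i \<in> sets borel" using B by simp
      then show "{xy \<in> space (seqR \<Otimes>\<^sub>M (seqX :: (nat \<Rightarrow> 'x) measure)). fst xy i \<in> B i} \<in> sets (seqR \<Otimes>\<^sub>M seqX)"
        by measurable
      show "{xy \<in> space (seqR \<Otimes>\<^sub>M (seqX :: (nat \<Rightarrow> 'x) measure)). snd xy i = y i} \<in> sets (seqR \<Otimes>\<^sub>M seqX)"
        by measurable
    qed simp
    then have "measure L ?S = prob (?WY -` ?S \<inter> space M)"
      unfolding L_def by (intro measure_distr WY)
    moreover have "?WY -` ?S \<inter> space M = ?D"
      using measurable_space[OF WY] by auto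
    moreover have "prob ?D = markov_fd mu (KG (clump_generator th Q)) n y *
       (\<Prod>i<n. measure (beta1 (th * (1 - Q (y i) (y i)))) (B i))"
    proof -
      have "emeasure M ?D = ennreal (markov_fd mu (KG (clump_generator th Q)) n y) *
          (\<Prod>i<n. ennreal (measure (beta1 (th * (1 - Q (y i) (y i)))) (B i)))"
        using emeasure_clump_fractions[of n B y] B th Q_le_1
        by (simp add: finite_measure.emeasure_eq_measure prob_space.finite_measure prob_space_beta1)
      then show ?thesis
        using markov_fd_KG_nonneg[of n y]
        by (simp add: measure_def prod_ennreal ennreal_mult[symmetric] prod_nonneg enn2real_nonneg del: ennreal_enn2real)
    qed
    ultimately show ?thesis
      by (simp add: L_def Ball_def algebra_simps)
  qed
  \<comment> \<open>The two pairs differ at most on the null set where the sticks fail to exhaust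
    the unit mass.\<close>
  have "distr M (seqR \<Otimes>\<^sub>M seqX) (\<lambda>\<omega>. (clumped (switch (?T \<omega>)) (RAM (?X \<omega>)), switchY (?T \<omega>))) =
      distr M (seqR \<Otimes>\<^sub>M seqX) (\<lambda>\<omega>. (RAM (clump_fraction (?X \<omega>) (?T \<omega>)), switchY (?T \<omega>)))"
  proof (rule distr_cong_AE)
    show "AE \<omega> in M. (clumped (switch (?T \<omega>)) (RAM (?X \<omega>)), switchY (?T \<omega>)) =
        (RAM (clump_fraction (?X \<omega>) (?T \<omega>)), switchY (?T \<omega>))"
      using AE_prod_tendsto_0[OF th X_indep X_distr]
      by eventually_elim (simp add: clumped_eq_RAM_clump_fraction)
    show "(\<lambda>\<omega>. (clumped (switch (?T \<omega>)) (RAM (?X \<omega>)), switchY (?T \<omega>))) \<in> measurable M (seqR \<Otimes>\<^sub>M seqX)"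
      by (intro measurable_Pair P Y)
    show "(\<lambda>\<omega>. (RAM (clump_fraction (?X \<omega>) (?T \<omega>)), switchY (?T \<omega>))) \<in> measurable M (seqR \<Otimes>\<^sub>M seqX)"
      by (intro measurable_Pair measurable_compose[OF W measurable_RAM] Y)
  qed simp_all
  also have "\<dots> = distr L (seqR \<Otimes>\<^sub>M seqX) (\<lambda>xy. (RAM (fst xy), snd xy))"
    unfolding L_def by (subst distr_distr[OF R WY]) (simp add: comp_def)
  finally have law: "distr M (seqR \<Otimes>\<^sub>M seqX) (\<lambda>\<omega>. (clumped (switch (?T \<omega>)) (RAM (?X \<omega>)), switchY (?T \<omega>))) =
      distr L (seqR \<Otimes>\<^sub>M seqX) (\<lambda>xy. (RAM (fst xy), snd xy))" .
  have "prob_space L"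
    unfolding L_def by (rule prob_space_distr[OF WY])
  moreover have "sets L = sets (seqR \<Otimes>\<^sub>M seqX)"
    by (simp add: L_def)
  ultimately show ?thesis
    unfolding is_MCcGEM_def using fdd law by blast
qed

end

theorem mainTheorem2:
  fixes M :: "'a measure" and th :: real
    and X :: "nat \<Rightarrow> 'a \<Rightarrow> real" and T :: "nat \<Rightarrow> 'a \<Rightarrow> 'x::countable"
    and Q :: "'x \<Rightarrow> 'x \<Rightarrow> real" and mu :: "'x pmf"
  assumes "prob_space M" and "th > 0"
    and "\<And>w z. Q w z \<ge> 0" and "\<And>w. ((\<lambda>z. Q w z) has_sum 1) UNIV"
    and "\<And>j. X j \<in> borel_measurable M"
    and "prob_space.indep_vars M (\<lambda>_. borel) X UNIV"
    and "\<And>j. distr M borel (X j) = beta1 th"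
    and "\<And>j. T j \<in> measurable M (count_space UNIV)"
    and "\<And>n y. measure M {\<omega> \<in> space M. \<forall>i<n. T i \<omega> = y i} = markov_fd mu Q n y"
    and "distr M (seqR \<Otimes>\<^sub>M seqX) (\<lambda>\<omega>. (\<lambda>j. X j \<omega>, \<lambda>j. T j \<omega>))
         = distr M seqR (\<lambda>\<omega> j. X j \<omega>) \<Otimes>\<^sub>M distr M seqX (\<lambda>\<omega> j. T j \<omega>)"
  shows "is_MCcGEM mu (\<lambda>w z. th * (Q w z - (if w = z then 1 else 0)))
           (distr M (seqR \<Otimes>\<^sub>M seqX)
              (\<lambda>\<omega>. (clumped (switch (\<lambda>j. T j \<omega>)) (RAM (\<lambda>j. X j \<omega>)),
                     switchY (\<lambda>j. T j \<omega>))))"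
proof -
  interpret prob_space M by fact
  interpret clumped_GEM M T Q mu th X
    using assms by unfold_locales auto
  show ?thesis
    by (rule is_MCcGEM_clumped)
qed

end
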